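(* Let $\pi$ be a non-empty set of primes, let $\sigma=\{\pi,\pi'\}$, let $\mathfrak{F}=\mathfrak{N}_{\sigma}$ be the class of all finite $\sigma$-nilpotent groups, and let $G$ be a finite group. If every maximal chain of $G$ of length $3$ includes a proper $K$-$\mathfrak{F}$-subnormal subgroup of $G$, then $G$ is $\pi$-separable.
   Context: All groups are finite. $\pi'$ is the set of all primes not in $\pi$. For $\sigma=\{\pi,\pi'\}$, a group is $\sigma$-primary if it is a $\pi$-group or a $\pi'$-group, and a group $G$ is $\sigma$-nilpotent if $G=G_1\times\cdots\times G_n$ for some $\sigma$-primary groups $G_1,\ldots,G_n$ (here: $G$ is the direct product of a $\pi$-group and a $\pi'$-group). For subgroups $B\le A$, $B_A$ denotes the normal core of $B$ in $A$ (the largest normal subgroup of $A$ contained in $B$). A subgroup $A$ of $G$ is $K$-$\mathfrak{F}$-subnormal in $G$ if there is a chain of subgroups $A=A_0\le A_1\le\cdots\le A_n=G$ such that for each $i=1,\ldots,n$ either $A_{i-1}\trianglelefteq A_i$ or $A_i/(A_{i-1})_{A_i}\in\mathfrak{F}$. A maximal chain of $G$ of length $n$ is a chain $M_n<M_{n-1}<\cdots<M_1<M_0=G$ where $M_i$ is a maximal subgroup of $M_{i-1}$ for all $i=1,\ldots,n$. It includes a proper $K$-$\mathfrak{F}$-subnormal subgroup if some $M_i$ with $i\ge 1$ is $K$-$\mathfrak{F}$-subnormal in $G$. $G$ is $\pi$-separable if every chief factor of $G$ is either a $\pi$-group or a $\pi'$-group. *)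

theory Defs
  imports "HOL-Algebra.Algebra"
begin

text \<open>
  A subgroup \<open>H\<close> of \<open>G\<close>, regarded as a group in its own right, is \<open>G\<lparr>carrier := H\<rparr>\<close>; a section
  \<open>H / K\<close> is \<open>G\<lparr>carrier := H\<rparr> Mod K\<close>. All groups are finite, so finiteness is part of
  being a \<open>\<pi>\<close>-group.
\<close>

definition pi_group :: "nat set \<Rightarrow> ('a, 'b) monoid_scheme \<Rightarrow> bool" where
  "pi_group \<pi> G \<longleftrightarrow>
     group G \<and> finite (carrier G) \<and> (\<forall>p. Factorial_Ring.prime p \<and> p dvd order G \<longrightarrow> p \<in> \<pi>)"

definition prime_complement :: "nat set \<Rightarrow> nat set" where
  "prime_complement \<pi> = {p. Factorial_Ring.prime p \<and> p \<notin> \<pi>}"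

definition sigma_primary :: "nat set set \<Rightarrow> ('a, 'b) monoid_scheme \<Rightarrow> bool" where
  "sigma_primary \<sigma> G \<longleftrightarrow> (\<exists>\<pi>\<in>\<sigma>. pi_group \<pi> G)"

text \<open>
  Taking the direct factors over the element type of \<open>G\<close> loses no generality: each factor
  is isomorphic to a subgroup of \<open>G\<close>.
\<close>

definition sigma_nilpotent :: "nat set set \<Rightarrow> ('a, 'b) monoid_scheme \<Rightarrow> bool" where
  "sigma_nilpotent \<sigma> G \<longleftrightarrow> group G \<and>
     (\<exists>(n::nat) (H :: nat \<Rightarrow> 'a monoid).
        (\<forall>i\<in>{1..n}. sigma_primary \<sigma> (H i)) \<and> G \<cong> product_group {1..n} H)"

text \<open>The order on sets is inclusion, so \<open>GREATEST\<close> selects the largest such normal subgroup.\<close>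

definition normal_core :: "('a, 'b) monoid_scheme \<Rightarrow> 'a set \<Rightarrow> 'a set" where
  "normal_core A B = (GREATEST N. N \<lhd> A \<and> N \<subseteq> B)"

text \<open>
  The class of groups is a predicate on groups over \<open>'a set\<close>, the type of the
  quotients to which it is applied.
\<close>

definition K_subnormal ::
  "('a set monoid \<Rightarrow> bool) \<Rightarrow> ('a, 'b) monoid_scheme \<Rightarrow> 'a set \<Rightarrow> bool" where
  "K_subnormal \<FF> G A \<longleftrightarrow>
     (\<exists>(n::nat) (C :: nat \<Rightarrow> 'a set).
        C 0 = A \<and> C n = carrier G \<and>
        (\<forall>i\<le>n. subgroup (C i) G) \<and>
        (\<forall>i\<in>{1..n}. C (i - 1) \<subseteq> C i \<and>
           (C (i - 1) \<lhd> G\<lparr>carrier := C i\<rparr> \<or>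
            \<FF> (G\<lparr>carrier := C i\<rparr> Mod normal_core (G\<lparr>carrier := C i\<rparr>) (C (i - 1))))))"

definition maximal_subgroup :: "'a set \<Rightarrow> ('a, 'b) monoid_scheme \<Rightarrow> bool" where
  "maximal_subgroup M G \<longleftrightarrow>
     subgroup M G \<and> M \<noteq> carrier G \<and>
     (\<forall>H. subgroup H G \<and> M \<subseteq> H \<longrightarrow> H = M \<or> H = carrier G)"

definition maximal_chain :: "('a, 'b) monoid_scheme \<Rightarrow> nat \<Rightarrow> (nat \<Rightarrow> 'a set) \<Rightarrow> bool" where
  "maximal_chain G n M \<longleftrightarrow>
     M 0 = carrier G \<and> (\<forall>i\<in>{1..n}. maximal_subgroup (M i) (G\<lparr>carrier := M (i - 1)\<rparr>))"

definition chief_factor :: "('a, 'b) monoid_scheme \<Rightarrow> 'a set \<Rightarrow> 'a set \<Rightarrow> bool" where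
  "chief_factor G H K \<longleftrightarrow>
     H \<lhd> G \<and> K \<lhd> G \<and> K \<subset> H \<and>
     (\<forall>N. N \<lhd> G \<and> K \<subseteq> N \<and> N \<subseteq> H \<longrightarrow> N = K \<or> N = H)"

definition pi_separable :: "nat set \<Rightarrow> ('a, 'b) monoid_scheme \<Rightarrow> bool" where
  "pi_separable \<pi> G \<longleftrightarrow>
     (\<forall>H K. chief_factor G H K \<longrightarrow>
        pi_group \<pi> (G\<lparr>carrier := H\<rparr> Mod K) \<or>
        pi_group (prime_complement \<pi>) (G\<lparr>carrier := H\<rparr> Mod K))"

text \<open>The \<open>GREATEST\<close> in \<open>normal_core\<close> is well defined: the core exists for every subgroup.\<close>

lemma normal_core_exists:
  assumes "group A" and "subgroup B A"
  shows "\<exists>N. (N \<lhd> A \<and> N \<subseteq> B) \<and> (\<forall>N'. N' \<lhd> A \<and> N' \<subseteq> B \<longrightarrow> N' \<subseteq> N)"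
proof -
  interpret A: group A by fact
  interpret B: subgroup B A by fact
  define N where
    "N = {x \<in> carrier A. \<forall>g\<in>carrier A. g \<otimes>\<^bsub>A\<^esub> x \<otimes>\<^bsub>A\<^esub> inv\<^bsub>A\<^esub> g \<in> B}"
  have mult: "x \<otimes>\<^bsub>A\<^esub> y \<in> N" if "x \<in> N" "y \<in> N" for x y
  proof -
    have "g \<otimes>\<^bsub>A\<^esub> (x \<otimes>\<^bsub>A\<^esub> y) \<otimes>\<^bsub>A\<^esub> inv\<^bsub>A\<^esub> g \<in> B" if g: "g \<in> carrier A" for g
    proof -
      have xy: "x \<in> carrier A" "y \<in> carrier A" using \<open>x \<in> N\<close> \<open>y \<in> N\<close> by (auto simp: N_def)
      have "g \<otimes>\<^bsub>A\<^esub> (x \<otimes>\<^bsub>A\<^esub> y) \<otimes>\<^bsub>A\<^esub> inv\<^bsub>A\<^esub> g =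
        (g \<otimes>\<^bsub>A\<^esub> x \<otimes>\<^bsub>A\<^esub> inv\<^bsub>A\<^esub> g) \<otimes>\<^bsub>A\<^esub> (g \<otimes>\<^bsub>A\<^esub> y \<otimes>\<^bsub>A\<^esub> inv\<^bsub>A\<^esub> g)"
        using xy g by (simp add: A.m_assoc A.inv_solve_left)
      then show ?thesis using \<open>x \<in> N\<close> \<open>y \<in> N\<close> g by (auto simp: N_def)
    qed
    then show ?thesis using that by (auto simp: N_def)
  qed
  have inv: "inv\<^bsub>A\<^esub> x \<in> N" if "x \<in> N" for x
  proof -
    have "g \<otimes>\<^bsub>A\<^esub> inv\<^bsub>A\<^esub> x \<otimes>\<^bsub>A\<^esub> inv\<^bsub>A\<^esub> g \<in> B" if g: "g \<in> carrier A" for g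
    proof -
      have x: "x \<in> carrier A" using \<open>x \<in> N\<close> by (auto simp: N_def)
      have "g \<otimes>\<^bsub>A\<^esub> inv\<^bsub>A\<^esub> x \<otimes>\<^bsub>A\<^esub> inv\<^bsub>A\<^esub> g = inv\<^bsub>A\<^esub> (g \<otimes>\<^bsub>A\<^esub> x \<otimes>\<^bsub>A\<^esub> inv\<^bsub>A\<^esub> g)"
        using x g by (simp add: A.inv_mult_group A.m_assoc)
      then show ?thesis using \<open>x \<in> N\<close> g by (auto simp: N_def)
    qed
    then show ?thesis using that by (auto simp: N_def)
  qed
  have "subgroup N A"
    by (rule A.subgroupI) (use mult inv in \<open>auto simp: N_def\<close>)
  moreover have "g \<otimes>\<^bsub>A\<^esub> x \<otimes>\<^bsub>A\<^esub> inv\<^bsub>A\<^esub> g \<in> N" if "g \<in> carrier A" "x \<in> N" for g x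
  proof -
    have x: "x \<in> carrier A" using \<open>x \<in> N\<close> by (auto simp: N_def)
    have "h \<otimes>\<^bsub>A\<^esub> (g \<otimes>\<^bsub>A\<^esub> x \<otimes>\<^bsub>A\<^esub> inv\<^bsub>A\<^esub> g) \<otimes>\<^bsub>A\<^esub> inv\<^bsub>A\<^esub> h =
      (h \<otimes>\<^bsub>A\<^esub> g) \<otimes>\<^bsub>A\<^esub> x \<otimes>\<^bsub>A\<^esub> inv\<^bsub>A\<^esub> (h \<otimes>\<^bsub>A\<^esub> g)" if "h \<in> carrier A" for h
      using x that \<open>g \<in> carrier A\<close> by (simp add: A.inv_mult_group A.m_assoc)
    then show ?thesis using that x by (simp add: N_def)
  qed
  ultimately have "N \<lhd> A" by (simp add: A.normal_inv_iff)
  moreover have "N \<subseteq> B"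
  proof
    fix x assume "x \<in> N"
    then have "\<one>\<^bsub>A\<^esub> \<otimes>\<^bsub>A\<^esub> x \<otimes>\<^bsub>A\<^esub> inv\<^bsub>A\<^esub> \<one>\<^bsub>A\<^esub> \<in> B" "x \<in> carrier A"
      unfolding N_def by blast+
    then show "x \<in> B" by simp
  qed
  moreover have "N' \<subseteq> N" if "N' \<lhd> A" "N' \<subseteq> B" for N'
    using that by (auto simp: N_def A.normal_inv_iff dest: subgroup.mem_carrier)
  ultimately show ?thesis by blast
qed

lemma normal_core:
  assumes "group A" and "subgroup B A"
  shows "normal_core A B \<lhd> A" and "normal_core A B \<subseteq> B"
    and "N \<lhd> A \<Longrightarrow> N \<subseteq> B \<Longrightarrow> N \<subseteq> normal_core A B"
proof -
  obtain M where M: "M \<lhd> A \<and> M \<subseteq> B" "\<And>N. N \<lhd> A \<and> N \<subseteq> B \<Longrightarrow> N \<subseteq> M"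
    using normal_core_exists[OF assms] by blast
  have "normal_core A B = M"
    unfolding normal_core_def by (rule Greatest_equality) (use M in auto)
  with M show "normal_core A B \<lhd> A" "normal_core A B \<subseteq> B"
    "N \<lhd> A \<Longrightarrow> N \<subseteq> B \<Longrightarrow> N \<subseteq> normal_core A B" by auto
qed

end

theory Submission
  imports Defs
begin

text \<open>
  Suppose that some chief factor $H / K$ of $G$ is mixed: its order is divisible by a prime in
  $\pi$ and by a prime outside $\pi$. In the quotient $G / K$, which satisfies the same
  condition on maximal chains (lemmas \<open>maximal_chain_preimage\<close> and
  \<open>K_subnormal_image\<close>), this factor is a minimal normal subgroup $N$. So let $N$ be
  a mixed minimal normal subgroup of $G$.

  Nothing in $N$ is close to being $\sigma$-nilpotent. Its centre is trivial, and no quotient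
  of $N$ by a proper normal subgroup is $\sigma$-nilpotent: otherwise, intersecting the
  conjugates of that subgroup, the $\pi$-elements of $N$ would commute with the $\pi'$-elements,
  and by minimality the $\pi'$-elements would be central. Moreover $N = L \, C_N(L)$ for every
  normal subgroup $L$ of $N$, so normality is transitive inside $N$. Walking down a chain that
  witnesses $K$-$\mathfrak{F}$-subnormality of $A$, the intersections with $N$ therefore stay
  normal in $N$ (\<open>subnormal_Int_normalized\<close>). If $A$ lies in a subgroup $M$ with $G
  = MN$ and $N \not\le M$, then all conjugates of $A \cap N$ lie in $M$, and minimality of $N$
  gives $A \cap N = 1$ (\<open>subnormal_below_supplement\<close>).

  If $N < G$, take a Sylow subgroup $P$ of $N$ and a maximal subgroup $M \ge N_G(P)$; then $G =
  MN$ by the Frattini argument. The maximal chains of length $3$ that start with $G > M$ and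
  continue above $M \cap N$ show that $P = M \cap N$, so $P$ is its own normalizer in $N$, and
  $P$ has no proper nontrivial subgroup. The conjugates of such a $P$ cover at least half of
  $N$. With two primes available, two disjoint halves together with the identity do not fit into
  $N$ (\<open>minimal_normal_is_whole\<close>).

  If $N = G$, then $G$ is simple, its proper $K$-$\mathfrak{F}$-subnormal subgroups are
  trivial, and so there is no chain $1 < U < V < W < G$ of subgroups. This makes all centralizers of
  nonidentity elements abelian, so that they partition $G \setminus \{1\}$, and counting the
  conjugacy classes of these centralizers gives a contradiction (\<open>no_such_group\<close>).
\<close>

section \<open>Conjugation, normalization and elements of prime order\<close>

definition pi_number :: "nat set \<Rightarrow> nat \<Rightarrow> bool" where
  "pi_number \<pi> n \<longleftrightarrow> (\<forall>p. Factorial_Ring.prime p \<and> p dvd n \<longrightarrow> p \<in> \<pi>)"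

lemma coprime_pi_numbers:
  assumes "pi_number \<pi> m" "pi_number (- \<pi>) n"
  shows "coprime m n"
proof (rule ccontr)
  assume "\<not> coprime m n"
  then have "gcd m n \<noteq> 1" by (simp add: coprime_iff_gcd_eq_1)
  then obtain p where "Factorial_Ring.prime p" "p dvd gcd m n" using prime_factor_nat by blast
  then show False using assms by (auto simp: pi_number_def)
qed

lemma pi_group_iff: "pi_group \<pi> G \<longleftrightarrow> group G \<and> finite (carrier G) \<and> pi_number \<pi> (order G)"
  by (simp add: pi_group_def pi_number_def)

definition (in group) conj_by :: "'a \<Rightarrow> 'a \<Rightarrow> 'a" where
  "conj_by g x = g \<otimes> x \<otimes> inv g"

definition (in group) normalizes :: "'a set \<Rightarrow> 'a set \<Rightarrow> bool" where
  "normalizes A B \<longleftrightarrow> (\<forall>a\<in>A. \<forall>b\<in>B. conj_by a b \<in> B)"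

definition (in group) centralizer :: "'a set \<Rightarrow> 'a set" where
  "centralizer S = {g \<in> carrier G. \<forall>s\<in>S. g \<otimes> s = s \<otimes> g}"

context group
begin

lemma conj_by_closed [simp]:
  "g \<in> carrier G \<Longrightarrow> x \<in> carrier G \<Longrightarrow> conj_by g x \<in> carrier G"
  by (simp add: conj_by_def)

lemma conj_by_one [simp]: "g \<in> carrier G \<Longrightarrow> conj_by g \<one> = \<one>"
  by (simp add: conj_by_def)

lemma one_conj_by [simp]: "x \<in> carrier G \<Longrightarrow> conj_by \<one> x = x"
  by (simp add: conj_by_def)

lemma conj_by_mult:
  "g \<in> carrier G \<Longrightarrow> x \<in> carrier G \<Longrightarrow> y \<in> carrier G \<Longrightarrow>
    conj_by g (x \<otimes> y) = conj_by g x \<otimes> conj_by g y"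
  by (simp add: conj_by_def m_assoc inv_solve_left)

lemma mult_conj_by:
  "g \<in> carrier G \<Longrightarrow> h \<in> carrier G \<Longrightarrow> x \<in> carrier G \<Longrightarrow>
    conj_by (g \<otimes> h) x = conj_by g (conj_by h x)"
  by (simp add: conj_by_def m_assoc inv_mult_group)

lemma conj_by_inv:
  "g \<in> carrier G \<Longrightarrow> x \<in> carrier G \<Longrightarrow> conj_by g (inv x) = inv (conj_by g x)"
  by (simp add: conj_by_def m_assoc inv_mult_group)

lemma conj_by_inv_cancel [simp]:
  "g \<in> carrier G \<Longrightarrow> x \<in> carrier G \<Longrightarrow> conj_by (inv g) (conj_by g x) = x"
  "g \<in> carrier G \<Longrightarrow> x \<in> carrier G \<Longrightarrow> conj_by g (conj_by (inv g) x) = x"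
  by (simp_all flip: mult_conj_by)

lemma conj_by_eq_iff [simp]:
  "g \<in> carrier G \<Longrightarrow> x \<in> carrier G \<Longrightarrow> y \<in> carrier G \<Longrightarrow>
    conj_by g x = conj_by g y \<longleftrightarrow> x = y"
  by (metis conj_by_inv_cancel(1))

lemma conj_by_eq_one_iff [simp]:
  "g \<in> carrier G \<Longrightarrow> x \<in> carrier G \<Longrightarrow> conj_by g x = \<one> \<longleftrightarrow> x = \<one>"
  by (metis conj_by_one conj_by_eq_iff one_closed)

lemma conj_by_pow:
  "g \<in> carrier G \<Longrightarrow> x \<in> carrier G \<Longrightarrow> conj_by g (x [^] (n::nat)) = conj_by g x [^] n"
  by (induction n) (simp_all add: conj_by_mult)

lemma conj_by_fixes_iff:
  "g \<in> carrier G \<Longrightarrow> x \<in> carrier G \<Longrightarrow> conj_by g x = x \<longleftrightarrow> g \<otimes> x = x \<otimes> g"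
  by (metis conj_by_def inv_solve_right m_closed)

lemma conj_by_conj_by:
  "g \<in> carrier G \<Longrightarrow> x \<in> carrier G \<Longrightarrow> y \<in> carrier G \<Longrightarrow>
    conj_by g (conj_by x y) = conj_by (conj_by g x) (conj_by g y)"
  by (simp add: conj_by_def[of x y] conj_by_def[of "conj_by g x"] conj_by_mult conj_by_inv)

lemma conj_by_commute_iff:
  "g \<in> carrier G \<Longrightarrow> x \<in> carrier G \<Longrightarrow> y \<in> carrier G \<Longrightarrow>
    conj_by g x \<otimes> conj_by g y = conj_by g y \<otimes> conj_by g x \<longleftrightarrow> x \<otimes> y = y \<otimes> x"
  by (simp flip: conj_by_mult)

lemma subgroup_conj_closed:
  "subgroup H G \<Longrightarrow> g \<in> H \<Longrightarrow> x \<in> H \<Longrightarrow> conj_by g x \<in> H"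
  by (simp add: conj_by_def subgroup.m_closed subgroup.m_inv_closed)

lemma subgroup_conj_image:
  assumes "subgroup H G" and "g \<in> carrier G"
  shows "subgroup (conj_by g ` H) G"
proof -
  interpret H: subgroup H G by fact
  show ?thesis
  proof (rule subgroupI)
    show "conj_by g ` H \<noteq> {}" using H.one_closed by blast
  qed (use assms(2) in \<open>auto simp flip: conj_by_mult conj_by_inv\<close>)
qed

lemma card_conj_image:
  assumes "H \<subseteq> carrier G" and "g \<in> carrier G"
  shows "card (conj_by g ` H) = card H"
  by (rule card_image) (use assms in \<open>auto simp: inj_on_def subset_iff\<close>)

lemma subgroup_in_subgroup_iff:
  assumes "subgroup A G"
  shows "subgroup B (G\<lparr>carrier := A\<rparr>) \<longleftrightarrow> subgroup B G \<and> B \<subseteq> A"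
proof
  assume B: "subgroup B (G\<lparr>carrier := A\<rparr>)"
  show "subgroup B G \<and> B \<subseteq> A"
    using incl_subgroup[OF assms B] subgroup.subset[OF B] by simp
qed (use subgroup_incl[OF _ assms] in blast)

lemma normal_in_subgroup_iff:
  assumes "subgroup A G"
  shows "B \<lhd> G\<lparr>carrier := A\<rparr> \<longleftrightarrow> subgroup B G \<and> B \<subseteq> A \<and> normalizes A B"
proof -
  interpret A: group "G\<lparr>carrier := A\<rparr>" by (rule subgroup_imp_group[OF assms])
  show ?thesis
    using m_inv_consistent[OF assms]
    by (auto simp: A.normal_inv_iff normalizes_def conj_by_def subgroup_in_subgroup_iff[OF assms])
qed

lemma normal_iff_normalizes:
  "N \<lhd> G \<longleftrightarrow> subgroup N G \<and> normalizes (carrier G) N"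
  by (auto simp: normal_inv_iff normalizes_def conj_by_def)

lemma normalizes_self: "subgroup A G \<Longrightarrow> normalizes A A"
  by (simp add: normalizes_def subgroup_conj_closed)

lemma mem_set_mult_iff: "x \<in> K <#> H \<longleftrightarrow> (\<exists>k\<in>K. \<exists>h\<in>H. x = k \<otimes> h)"
  by (auto simp: set_mult_def)

lemma product_subgroup:
  assumes "subgroup A G" "subgroup K G" "K \<subseteq> A" "normalizes A K" "subgroup H G" "H \<subseteq> A"
  shows "subgroup (K <#> H) G" and "K <#> H \<subseteq> A"
  using mult_norm_sub_in_sub[of K A H] assms normal_in_subgroup_iff[of A K]
    subgroup_in_subgroup_iff[of A] by auto

lemma subgroup_nat_pow_closed:
  "subgroup H G \<Longrightarrow> x \<in> H \<Longrightarrow> x [^] (n::nat) \<in> H"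
  by (induction n) (simp_all add: subgroup.one_closed subgroup.m_closed)

lemma centralizer_subgroup:
  assumes "S \<subseteq> carrier G"
  shows "subgroup (centralizer S) G"
proof (rule subgroupI)
  show "inv a \<in> centralizer S" if "a \<in> centralizer S" for a
  proof -
    have a: "a \<in> carrier G" using that by (simp add: centralizer_def)
    have "inv a \<otimes> s = s \<otimes> inv a" if s: "s \<in> S" for s
    proof -
      have "s \<in> carrier G" using assms s by blast
      moreover have "a \<otimes> s = s \<otimes> a"
        using \<open>a \<in> centralizer S\<close> s by (simp add: centralizer_def)
      ultimately show ?thesis
        using a by (metis conj_by_fixes_iff conj_by_inv_cancel(1) inv_closed)
    qed
    then show ?thesis using a by (simp add: centralizer_def)
  qed
  show "a \<otimes> b \<in> centralizer S" if "a \<in> centralizer S" "b \<in> centralizer S" for a b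
  proof -
    have ab: "a \<in> carrier G" "b \<in> carrier G" using that by (simp_all add: centralizer_def)
    have "conj_by (a \<otimes> b) s = s" if s: "s \<in> S" for s
    proof -
      have sc: "s \<in> carrier G" using assms s by blast
      have "a \<otimes> s = s \<otimes> a" "b \<otimes> s = s \<otimes> b"
        using \<open>a \<in> centralizer S\<close> \<open>b \<in> centralizer S\<close> s by (simp_all add: centralizer_def)
      then have "conj_by a s = s" "conj_by b s = s" using ab sc by (simp_all add: conj_by_fixes_iff)
      then show ?thesis using ab sc by (simp add: mult_conj_by)
    qed
    then show ?thesis using ab assms by (auto simp: centralizer_def conj_by_fixes_iff subset_iff)
  qed
qed (use assms in \<open>auto simp: centralizer_def subset_iff intro!: exI[of _ \<one>]\<close>)

lemma exists_order_p_subgroup: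
  assumes "finite (carrier G)" "subgroup H G" "Factorial_Ring.prime p" "p dvd card H"
  shows "\<exists>P. subgroup P G \<and> P \<subseteq> H \<and> card P = p"
proof -
  interpret H: group "G\<lparr>carrier := H\<rparr>" by (rule subgroup_imp_group) fact
  obtain m where m: "card H = p * m" using assms(4) by blast
  have "finite H" using assms(1,2) finite_subset subgroup.subset by blast
  then obtain P where "subgroup P (G\<lparr>carrier := H\<rparr>)" "card P = p"
    using sylow_thm[OF assms(3) H.is_group, of 1 m] m by (auto simp: order_def)
  then show ?thesis using subgroup_in_subgroup_iff[OF assms(2)] by blast
qed

lemma subgroup_pow_card:
  assumes "finite (carrier G)" "subgroup H G" "x \<in> H"
  shows "x [^] card H = \<one>"
proof -
  interpret H: group "G\<lparr>carrier := H\<rparr>" by (rule subgroup_imp_group) fact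
  have "x [^]\<^bsub>G\<lparr>carrier := H\<rparr>\<^esub> order (G\<lparr>carrier := H\<rparr>) = \<one>\<^bsub>G\<lparr>carrier := H\<rparr>\<^esub>"
    by (rule H.pow_order_eq_1) (use assms in simp)
  then show ?thesis by (simp add: order_def nat_pow_consistent[symmetric])
qed

lemma card_subgroup_dvd:
  assumes "subgroup H G" "subgroup K G" "H \<subseteq> K"
  shows "card H dvd card K"
proof -
  interpret K: group "G\<lparr>carrier := K\<rparr>" by (rule subgroup_imp_group) fact
  have "subgroup H (G\<lparr>carrier := K\<rparr>)" using assms by (simp add: subgroup_in_subgroup_iff)
  from K.lagrange[OF this] have "card K = card (rcosets\<^bsub>G\<lparr>carrier := K\<rparr>\<^esub> H) * card H"
    by (simp add: order_def)
  then show ?thesis by (metis dvd_triv_right)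
qed

lemma cauchy_in_subgroup:
  assumes "finite (carrier G)" "subgroup H G" "Factorial_Ring.prime p" "p dvd card H"
  shows "\<exists>x\<in>H. x \<noteq> \<one> \<and> x [^] p = \<one>"
proof -
  obtain P where P: "subgroup P G" "P \<subseteq> H" "card P = p"
    using exists_order_p_subgroup[OF assms] by blast
  have "P \<noteq> {\<one>}" using P(3) assms(3) by auto
  then obtain x where "x \<in> P" "x \<noteq> \<one>"
    using subgroup.one_closed[OF P(1)] by blast
  then show ?thesis using subgroup_pow_card[OF assms(1) P(1)] P by blast
qed

lemma coprime_powers_eq_one:
  assumes "x \<in> carrier G" "x [^] (m::nat) = \<one>" "x [^] (n::nat) = \<one>" "coprime m n"
  shows "x = \<one>"
  using assms by (metis coprime_common_divisor_nat ord_eq_1 pow_eq_id)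

text \<open>
  The conjugates of \<open>x\<close> generate a nontrivial normal subgroup inside the minimal normal
  subgroup \<open>N\<close>, hence all of \<open>N\<close>. To prove a property that defines a subgroup \<open>E\<close> for every
  element of \<open>N\<close>, it thus suffices to check it on the conjugates of a single element.
\<close>

lemma conjugates_in_subgroup:
  assumes N: "chief_factor G N {\<one>}" and E: "subgroup E G"
    and x: "x \<in> N" "x \<noteq> \<one>" and conj: "\<And>g. g \<in> carrier G \<Longrightarrow> conj_by g x \<in> E"
  shows "N \<subseteq> E"
proof -
  have NG: "N \<lhd> G" and min: "\<And>L. L \<lhd> G \<Longrightarrow> L \<subseteq> N \<Longrightarrow> \<one> \<in> L \<Longrightarrow> L = {\<one>} \<or> L = N"
    using N by (auto simp: chief_factor_def)
  then have nN: "normalizes (carrier G) N" "subgroup N G"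
    by (simp_all add: normal_iff_normalizes)
  have xc: "x \<in> carrier G" using nN(2) x(1) subgroup.mem_carrier by metis
  define S where "S = (\<lambda>g. conj_by g x) ` carrier G"
  have SG: "S \<subseteq> carrier G" using xc by (auto simp: S_def)
  have "generate G S \<lhd> G"
  proof (rule normal_generateI[OF SG])
    fix h g assume "h \<in> S" and g: "g \<in> carrier G"
    then obtain k where k: "k \<in> carrier G" "h = conj_by k x" by (auto simp: S_def)
    then have "g \<otimes> h \<otimes> inv g = conj_by (g \<otimes> k) x"
      using g xc by (simp add: mult_conj_by) (simp add: conj_by_def)
    then show "g \<otimes> h \<otimes> inv g \<in> S" using k g by (auto simp: S_def)
  qed
  moreover have "generate G S \<subseteq> N"
    by (rule generate_subgroup_incl) (use nN x in \<open>auto simp: S_def normalizes_def\<close>)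
  moreover have "x \<in> generate G S"
    unfolding S_def by (rule generate.incl, rule image_eqI[of _ _ \<one>]) (use xc in simp_all)
  ultimately have "generate G S = N"
    using min[of "generate G S"] x(2) generate.one by blast
  moreover have "generate G S \<subseteq> E"
    by (rule generate_subgroup_incl) (use E conj in \<open>auto simp: S_def\<close>)
  ultimately show ?thesis by simp
qed

end

section \<open>Subnormality relative to a mixed minimal normal subgroup\<close>

text \<open>
  For \<open>L\<close> normal in \<open>A\<close>, this says that in the quotient of \<open>A\<close> by \<open>L\<close> every \<open>\<pi>\<close>-element commutes
  with every \<open>\<pi>'\<close>-element, which is what \<open>\<sigma>\<close>-nilpotency of the quotient means. Phrased for
  elements of \<open>A\<close>, the condition visibly survives intersecting \<open>A\<close> and \<open>L\<close> with a subgroup.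
\<close>

definition (in group) hall_parts_commute :: "nat set \<Rightarrow> 'a set \<Rightarrow> 'a set \<Rightarrow> bool" where
  "hall_parts_commute \<pi> A L \<longleftrightarrow>
     (\<forall>a\<in>A. \<forall>b\<in>A. \<forall>m n. pi_number \<pi> m \<and> pi_number (- \<pi>) n \<and>
        a [^] (m::nat) \<in> L \<and> b [^] (n::nat) \<in> L \<longrightarrow> conj_by a b \<otimes> inv b \<in> L)"

text \<open>
  The subgroup \<open>L\<close> plays the part of the core of \<open>B\<close> in \<open>A\<close>. Leaving it free to be any normal
  subgroup of \<open>A\<close> inside \<open>B\<close> makes the normal case the instance \<open>L = B\<close>.
\<close>

inductive (in group) elementwise_subnormal :: "nat set \<Rightarrow> 'a set \<Rightarrow> bool" for \<pi> where
  whole: "elementwise_subnormal \<pi> (carrier G)"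
| step: "elementwise_subnormal \<pi> B" if "elementwise_subnormal \<pi> A" "subgroup B G" "B \<subseteq> A"
    "subgroup L G" "L \<subseteq> B" "normalizes A L" "L = B \<or> hall_parts_commute \<pi> A L"

locale mixed_minimal_normal = group +
  fixes \<pi> :: "nat set" and N :: "'a set" and p q :: nat
  assumes finite_carrier: "finite (carrier G)"
    and minimal: "chief_factor G N {\<one>}"
    and p: "Factorial_Ring.prime p" "p dvd card N" "p \<in> \<pi>"
    and q: "Factorial_Ring.prime q" "q dvd card N" "q \<notin> \<pi>"
begin

lemma N_subgroup: "subgroup N G" and N_normalized: "normalizes (carrier G) N"
  using minimal by (simp_all add: chief_factor_def normal_iff_normalizes)

lemma N_carrier: "x \<in> N \<Longrightarrow> x \<in> carrier G"
  using N_subgroup subgroup.mem_carrier by metis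

text \<open>
  A nontrivial centre would make \<open>N\<close> abelian by minimality. The elements of order dividing \<open>p\<close>
  would then form a subgroup containing all conjugates of one element of order \<open>p\<close>, so \<open>N\<close> would
  have exponent \<open>p\<close>, although it has an element of order \<open>q\<close>.
\<close>

lemma center_N_trivial:
  assumes "z \<in> N" "z \<in> centralizer N"
  shows "z = \<one>"
proof (rule ccontr)
  assume z: "z \<noteq> \<one>"
  have zc: "z \<in> carrier G" using assms(1) by (rule N_carrier)
  have NG: "N \<subseteq> carrier G" using N_carrier by blast
  have "conj_by g z \<in> centralizer N" if g: "g \<in> carrier G" for g
  proof -
    have "conj_by g z \<otimes> y = y \<otimes> conj_by g z" if y: "y \<in> N" for y
    proof -
      have yc: "y \<in> carrier G" using y by (rule N_carrier)
      have "conj_by (inv g) y \<in> N" using y g N_normalized by (simp add: normalizes_def)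
      then have "z \<otimes> conj_by (inv g) y = conj_by (inv g) y \<otimes> z"
        using assms(2) by (simp add: centralizer_def)
      then show ?thesis
        using conj_by_commute_iff[OF g zc, of "conj_by (inv g) y"] g yc by simp
    qed
    then show ?thesis using g zc by (simp add: centralizer_def)
  qed
  then have "N \<subseteq> centralizer N"
    by (rule conjugates_in_subgroup[OF minimal centralizer_subgroup[OF NG] assms(1) z])
  then have comm: "x \<otimes> y = y \<otimes> x" if "x \<in> N" "y \<in> N" for x y
    using that by (auto simp: centralizer_def)
  have pow: "(x \<otimes> y) [^] (n::nat) = x [^] n \<otimes> y [^] n" if "x \<in> N" "y \<in> N" for x y n
    using that comm by (simp add: pow_mult_distrib N_carrier)
  define E where "E = {x \<in> N. x [^] p = \<one>}"
  have E: "subgroup E G"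
  proof (rule subgroupI)
    show "E \<noteq> {}" using subgroup.one_closed[OF N_subgroup] by (auto simp: E_def)
  qed (use subgroup.m_closed[OF N_subgroup] subgroup.m_inv_closed[OF N_subgroup] in
      \<open>auto simp: E_def pow N_carrier nat_pow_inv\<close>)
  obtain x where x: "x \<in> N" "x \<noteq> \<one>" "x [^] p = \<one>"
    using cauchy_in_subgroup[OF finite_carrier N_subgroup p(1,2)] by blast
  obtain y where y: "y \<in> N" "y \<noteq> \<one>" "y [^] q = \<one>"
    using cauchy_in_subgroup[OF finite_carrier N_subgroup q(1,2)] by blast
  have "conj_by g x \<in> E" if g: "g \<in> carrier G" for g
    using g x N_normalized conj_by_pow[OF g N_carrier[OF x(1)], of p]
    by (simp add: E_def normalizes_def)
  then have "N \<subseteq> E" by (rule conjugates_in_subgroup[OF minimal E x(1,2)])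
  then have "y [^] p = \<one>" using y by (auto simp: E_def)
  moreover have "coprime p q" using p q primes_coprime by blast
  ultimately show False using coprime_powers_eq_one y N_carrier by blast
qed

lemma commutator_eq_one_iff:
  assumes "a \<in> carrier G" "b \<in> carrier G"
  shows "conj_by a b \<otimes> inv b = \<one> \<longleftrightarrow> a \<otimes> b = b \<otimes> a"
  using assms by (metis conj_by_closed conj_by_fixes_iff inv_closed inv_equality inv_inv r_inv)

text \<open>
  If \<open>K \<noteq> N\<close>, a nontrivial commutator of a \<open>\<pi>\<close>-element and a \<open>\<pi>'\<close>-element of \<open>N\<close> would have all its
  conjugates in \<open>K\<close>. Hence the two kinds of elements commute, the centralizer of the set of
  \<open>\<pi>'\<close>-elements contains every conjugate of an element of order \<open>p\<close>, and so it contains \<open>N\<close>; this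
  puts an element of order \<open>q\<close> into the centre.
\<close>

lemma hall_parts_commute_imp_whole:
  assumes K: "subgroup K G" "K \<subseteq> N" and hc: "hall_parts_commute \<pi> N K"
  shows "K = N"
proof (rule ccontr)
  assume "K \<noteq> N"
  then have NK: "\<not> N \<subseteq> K" using K by blast
  have comm: "a \<otimes> b = b \<otimes> a"
    if ab: "a \<in> N" "b \<in> N" and mn: "pi_number \<pi> m" "pi_number (- \<pi>) n"
      and pw: "a [^] m = \<one>" "b [^] n = \<one>" for a b and m n :: nat
  proof (rule ccontr)
    have abc: "a \<in> carrier G" "b \<in> carrier G" using ab by (simp_all add: N_carrier)
    define c where "c = conj_by a b \<otimes> inv b"
    assume "a \<otimes> b \<noteq> b \<otimes> a"
    then have c1: "c \<noteq> \<one>" using abc by (simp add: c_def commutator_eq_one_iff)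
    have cN: "c \<in> N" unfolding c_def
      using ab N_subgroup by (simp add: subgroup_conj_closed subgroup.m_closed subgroup.m_inv_closed)
    have "conj_by g c \<in> K" if g: "g \<in> carrier G" for g
    proof -
      let ?a = "conj_by g a" and ?b = "conj_by g b"
      have "?a \<in> N" "?b \<in> N" using ab g N_normalized by (simp_all add: normalizes_def)
      moreover have "?a [^] m \<in> K" "?b [^] n \<in> K"
        using pw g abc subgroup.one_closed[OF K(1)] by (simp_all flip: conj_by_pow)
      ultimately have "conj_by ?a ?b \<otimes> inv ?b \<in> K"
        using hc mn unfolding hall_parts_commute_def by blast
      moreover have "conj_by g c = conj_by ?a ?b \<otimes> inv ?b"
        using g abc by (simp add: c_def conj_by_mult conj_by_inv
            conj_by_conj_by[of g a b])
      ultimately show ?thesis by simp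
    qed
    then have "N \<subseteq> K" by (rule conjugates_in_subgroup[OF minimal K(1) cN c1])
    with NK show False by simp
  qed
  define V where "V = {b \<in> N. \<exists>n. pi_number (- \<pi>) n \<and> b [^] (n::nat) = \<one>}"
  have VG: "V \<subseteq> carrier G" by (auto simp: V_def N_carrier)
  have pp: "pi_number \<pi> p" and qq: "pi_number (- \<pi>) q"
    using p q by (auto simp: pi_number_def dest: primes_dvd_imp_eq)
  obtain x where x: "x \<in> N" "x \<noteq> \<one>" "x [^] p = \<one>"
    using cauchy_in_subgroup[OF finite_carrier N_subgroup p(1,2)] by blast
  obtain y where y: "y \<in> N" "y \<noteq> \<one>" "y [^] q = \<one>"
    using cauchy_in_subgroup[OF finite_carrier N_subgroup q(1,2)] by blast
  have "conj_by g x \<in> centralizer V" if g: "g \<in> carrier G" for g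
  proof -
    have xg: "conj_by g x \<in> N" "conj_by g x [^] p = \<one>"
      using g x N_normalized N_carrier[OF x(1)] by (simp_all add: normalizes_def flip: conj_by_pow)
    then have "conj_by g x \<otimes> b = b \<otimes> conj_by g x" if "b \<in> V" for b
      using that comm pp unfolding V_def by blast
    then show ?thesis using xg(1) by (simp add: centralizer_def N_carrier)
  qed
  then have "N \<subseteq> centralizer V"
    by (rule conjugates_in_subgroup[OF minimal centralizer_subgroup[OF VG] x(1,2)])
  moreover have "y \<in> V" using y qq by (auto simp: V_def)
  ultimately have "y \<in> centralizer N"
    using N_carrier[OF y(1)] by (auto simp: centralizer_def)
  then show False using center_N_trivial y by blast
qed

text \<open>
  Complete reducibility of \<open>N\<close>, without decomposing it into simple factors. Let \<open>T\<close> be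
  a minimal normal subgroup of \<open>N\<close>. For each \<open>g\<close>, the intersection of \<open>T\<close> with a conjugate of \<open>K\<close> is
  \<open>T\<close> or trivial, so the conjugate of \<open>T\<close> by \<open>g\<close> lies in \<open>K\<close> or centralizes \<open>K\<close>. In both cases it
  lies in the product of \<open>K\<close> with its centralizer, which thus contains all of \<open>N\<close>.
\<close>

lemma normal_centralizer_decomposition:
  assumes K: "subgroup K G" "K \<subseteq> N" "normalizes N K" and x: "x \<in> N"
  shows "\<exists>k\<in>K. \<exists>c\<in>N \<inter> centralizer K. x = k \<otimes> c"
proof -
  define C where "C = N \<inter> centralizer K"
  define E where "E = K <#> C"
  have Kc: "k \<in> carrier G" if "k \<in> K" for k using that K(2) N_carrier by blast
  have Csub: "subgroup C G"
    unfolding C_def using K(2) N_carrier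
    by (intro subgroups_Inter_pair N_subgroup centralizer_subgroup) blast
  have Cc: "c \<in> carrier G" if "c \<in> C" for c using that N_carrier by (simp add: C_def)
  have CK: "c \<otimes> k = k \<otimes> c" if "c \<in> C" "k \<in> K" for c k
    using that by (auto simp: C_def centralizer_def)
  have E: "subgroup E G"
    unfolding E_def by (rule product_subgroup(1)[OF N_subgroup K Csub]) (simp add: C_def)
  \<comment> \<open>A member of least order is a minimal normal subgroup of \<open>N\<close>.\<close>
  define \<T> where "\<T> = {T. subgroup T G \<and> T \<subseteq> N \<and> normalizes N T \<and> T \<noteq> {\<one>}}"
  have "N \<noteq> {\<one>}" using minimal by (auto simp: chief_factor_def)
  then have "N \<in> \<T>" by (simp add: \<T>_def N_subgroup normalizes_self)
  then obtain T where T: "T \<in> \<T>" and Tmin: "\<And>T'. T' \<in> \<T> \<Longrightarrow> card T \<le> card T'"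
    using exists_least_iff[of "\<lambda>n. \<exists>T\<in>\<T>. card T = n"] by (metis linorder_not_le)
  then have T': "subgroup T G" "T \<subseteq> N" "normalizes N T" "T \<noteq> {\<one>}" by (simp_all add: \<T>_def)
  have finT: "finite T" using T'(1) finite_carrier finite_subset subgroup.subset by metis
  obtain t where t: "t \<in> T" "t \<noteq> \<one>" using T'(1,4) subgroup.one_closed by blast
  have tN: "t \<in> N" and tc: "t \<in> carrier G" using t T'(2) N_carrier by auto
  have "conj_by g t \<in> E" if g: "g \<in> carrier G" for g
  proof -
    define K' where "K' = conj_by (inv g) ` K"
    have K': "subgroup K' G" unfolding K'_def using K(1) g by (simp add: subgroup_conj_image)
    have nK': "normalizes N K'"
    proof -
      have "conj_by n (conj_by (inv g) k) \<in> K'" if "n \<in> N" "k \<in> K" for n k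
      proof -
        have nc: "n \<in> carrier G" "k \<in> carrier G" using that Kc N_carrier by auto
        have "conj_by g n \<in> N" using that g N_normalized by (simp add: normalizes_def)
        then have "conj_by (conj_by g n) k \<in> K" using that K(3) by (simp add: normalizes_def)
        moreover have "conj_by n (conj_by (inv g) k) = conj_by (inv g) (conj_by (conj_by g n) k)"
        proof -
          have "conj_by g n = g \<otimes> n \<otimes> inv g" by (simp add: conj_by_def)
          then show ?thesis using g nc by (simp add: mult_conj_by)
        qed
        ultimately show ?thesis by (simp add: K'_def)
      qed
      then show ?thesis by (auto simp: normalizes_def K'_def)
    qed
    have TK: "subgroup (T \<inter> K') G" using T'(1) K' by (rule subgroups_Inter_pair)
    have nTK: "normalizes N (T \<inter> K')" using T'(3) nK' by (auto simp: normalizes_def)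
    show ?thesis
    proof (cases "T \<inter> K' = {\<one>}")
      case False
      then have "T \<inter> K' \<in> \<T>" using TK nTK T'(2) by (auto simp: \<T>_def)
      then have "T \<inter> K' = T" using Tmin finT by (metis Int_lower1 card_seteq)
      then obtain k where "k \<in> K" "t = conj_by (inv g) k" using t(1) by (auto simp: K'_def)
      then have "conj_by g t = k \<otimes> \<one>" "k \<in> K" using g by (simp_all add: Kc)
      then show ?thesis using subgroup.one_closed[OF Csub] by (auto simp: E_def mem_set_mult_iff)
    next
      case True
      \<comment> \<open>\<open>T\<close> and \<open>K'\<close> are normal in \<open>N\<close> and meet trivially, so they commute elementwise;
        conjugating by \<open>g\<close> carries this to \<open>K\<close>.\<close>
      have "conj_by g t \<otimes> k = k \<otimes> conj_by g t" if k: "k \<in> K" for k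
      proof -
        define h where "h = conj_by (inv g) k"
        have hK: "h \<in> K'" using k by (simp add: h_def K'_def)
        have hc: "h \<in> carrier G" using k g by (simp add: h_def Kc)
        have kN: "k \<in> N" using k K(2) by blast
        have hN: "h \<in> N" using kN g N_normalized by (simp add: h_def normalizes_def)
        have "conj_by t h \<otimes> inv h \<in> K'"
          using hK tN nK' K' by (simp add: normalizes_def subgroup.m_closed subgroup.m_inv_closed)
        moreover have "conj_by t h \<otimes> inv h = t \<otimes> conj_by h (inv t)"
          using tc hc by (simp add: conj_by_def m_assoc)
        moreover have "t \<otimes> conj_by h (inv t) \<in> T"
          using t(1) hN T'(1,3) by (simp add: normalizes_def subgroup.m_closed subgroup.m_inv_closed)
        ultimately have "conj_by t h \<otimes> inv h = \<one>" using True by auto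
        then have "t \<otimes> h = h \<otimes> t" using tc hc by (simp add: commutator_eq_one_iff)
        then have "conj_by g t \<otimes> conj_by g h = conj_by g h \<otimes> conj_by g t"
          using g tc hc by (simp add: conj_by_commute_iff)
        then show ?thesis using g k by (simp add: h_def Kc)
      qed
      moreover have "conj_by g t \<in> N" using tN g N_normalized by (simp add: normalizes_def)
      ultimately have "conj_by g t \<in> C" using g tc by (simp add: C_def centralizer_def)
      then have "\<one> \<otimes> conj_by g t \<in> E" using subgroup.one_closed[OF K(1)] unfolding E_def mem_set_mult_iff by blast
      then show ?thesis using g tc by simp
    qed
  qed
  then have "N \<subseteq> E" by (rule conjugates_in_subgroup[OF minimal E tN t(2)])
  then show ?thesis using x by (auto simp: E_def mem_set_mult_iff C_def)
qed

text \<open>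
  One step down a subnormal chain inside \<open>N\<close>. With \<open>N = B C\<close> for the centralizer \<open>C\<close> of \<open>B\<close>,
  a subgroup of \<open>B\<close> normalized by \<open>B\<close> is normalized by \<open>N\<close>. If moreover \<open>B\<close> modulo \<open>L\<close> is
  \<open>\<sigma>\<close>-nilpotent, so is \<open>N\<close> modulo \<open>L C\<close>, since this is a quotient of \<open>B\<close> modulo \<open>L\<close>; therefore
  \<open>L C = N\<close>, and \<open>B \<inter> C = 1\<close> yields \<open>L = B\<close>.
\<close>

lemma normal_chain_step:
  assumes B: "subgroup B G" "B \<subseteq> N" "normalizes N B"
    and L: "subgroup L G" "L \<subseteq> B" "normalizes B L"
  shows "normalizes N L" and "hall_parts_commute \<pi> B L \<Longrightarrow> L = B"
proof -
  define C where "C = N \<inter> centralizer B"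
  have Bc: "b \<in> carrier G" if "b \<in> B" for b using that B(2) N_carrier by blast
  have Cc: "c \<in> carrier G" if "c \<in> C" for c using that N_carrier by (simp add: C_def)
  have Csub: "subgroup C G"
    unfolding C_def using B(2) N_carrier
    by (intro subgroups_Inter_pair N_subgroup centralizer_subgroup) blast
  have CB: "c \<otimes> b = b \<otimes> c" if "c \<in> C" "b \<in> B" for b c
    using that by (auto simp: C_def centralizer_def)
  have fixC: "conj_by c b = b" if "c \<in> C" "b \<in> B" for b c
    using that CB by (simp add: conj_by_fixes_iff Bc Cc)
  have dec: "\<exists>b\<in>B. \<exists>c\<in>C. x = b \<otimes> c" if "x \<in> N" for x
    using normal_centralizer_decomposition[OF B that] by (simp add: C_def)
  show normL: "normalizes N L"
    unfolding normalizes_def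
  proof (intro ballI)
    fix x l assume "x \<in> N" and l: "l \<in> L"
    then obtain b c where bc: "b \<in> B" "c \<in> C" "x = b \<otimes> c" using dec by blast
    then have "conj_by x l = conj_by b l"
      using l L(2) by (simp add: mult_conj_by fixC Bc Cc subset_iff)
    then show "conj_by x l \<in> L" using bc l L(3) by (simp add: normalizes_def)
  qed
  have BC: "x = \<one>" if x: "x \<in> B" "x \<in> C" for x
  proof (rule center_N_trivial)
    show "x \<in> N" using x B(2) by blast
    have "x \<otimes> y = y \<otimes> x" if y: "y \<in> N" for y
    proof -
      obtain b c where bc: "b \<in> B" "c \<in> C" "y = b \<otimes> c" using dec y by blast
      have "conj_by x b = b" using fixC x bc by simp
      moreover have "conj_by x c = c" using CB[OF bc(2) x(1)] x bc by (simp add: conj_by_fixes_iff Bc Cc)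
      ultimately have "conj_by x y = y" using bc x by (simp add: conj_by_mult Bc Cc)
      then show ?thesis using bc x by (simp add: conj_by_fixes_iff Bc Cc)
    qed
    then show "x \<in> centralizer N" using x by (simp add: centralizer_def Bc)
  qed
  assume hc: "hall_parts_commute \<pi> B L"
  define K where "K = L <#> C"
  have Lc: "l \<in> carrier G" if "l \<in> L" for l using that L(2) Bc by blast
  have K: "subgroup K G" "K \<subseteq> N"
    unfolding K_def using L(2) B(2)
    by (intro product_subgroup[OF N_subgroup L(1) _ normL Csub]; auto simp: C_def)+
  have K_cancel: "b \<in> L" if "b \<in> B" "c \<in> C" "b \<otimes> c \<in> K" for b c
  proof -
    obtain l d where ld: "l \<in> L" "d \<in> C" "b \<otimes> c = l \<otimes> d" using \<open>b \<otimes> c \<in> K\<close> by (auto simp: K_def mem_set_mult_iff)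
    have "inv l \<otimes> b \<in> B"
      using ld L(2) that B(1) by (auto intro: subgroup.m_closed subgroup.m_inv_closed)
    moreover have "inv l \<otimes> b = d \<otimes> inv c"
      using ld that by (metis Bc Cc Lc inv_closed inv_solve_left inv_solve_right m_assoc m_closed)
    then have "inv l \<otimes> b \<in> C"
      using ld that Csub by (simp add: subgroup.m_closed subgroup.m_inv_closed)
    ultimately have "inv l \<otimes> b = \<one>" by (rule BC)
    then have "b = l" using ld that Bc Lc by (metis inv_equality inv_inv inv_closed)
    then show ?thesis using ld by simp
  qed
  have "hall_parts_commute \<pi> N K"
    unfolding hall_parts_commute_def
  proof (intro ballI allI impI, elim conjE)
    fix x y and m n :: nat
    assume xy: "x \<in> N" "y \<in> N" and mn: "pi_number \<pi> m" "pi_number (- \<pi>) n"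
      and pw: "x [^] m \<in> K" "y [^] n \<in> K"
    obtain a c where ac: "a \<in> B" "c \<in> C" "x = a \<otimes> c" using dec xy by blast
    obtain b d where bd: "b \<in> B" "d \<in> C" "y = b \<otimes> d" using dec xy by blast
    have c: "a \<in> carrier G" "b \<in> carrier G" "c \<in> carrier G" "d \<in> carrier G"
      using ac bd Bc Cc by auto
    have "x [^] m = a [^] m \<otimes> c [^] m" "y [^] n = b [^] n \<otimes> d [^] n"
      using ac bd CB[OF ac(2,1)] CB[OF bd(2,1)] c by (simp_all add: pow_mult_distrib)
    moreover have "a [^] m \<in> B" "c [^] m \<in> C" "b [^] n \<in> B" "d [^] n \<in> C"
      using ac bd B(1) Csub subgroup_nat_pow_closed by auto
    ultimately have "a [^] m \<in> L" "b [^] n \<in> L" using pw K_cancel by auto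
    then have l: "conj_by a b \<otimes> inv b \<in> L"
      using hc mn ac bd unfolding hall_parts_commute_def by blast
    have "conj_by x y = conj_by a b \<otimes> conj_by c d"
    proof -
      have "conj_by c b = b" "conj_by c d \<in> C"
        using fixC ac bd Csub by (simp_all add: subgroup_conj_closed)
      moreover from this have "conj_by a (conj_by c d) = conj_by c d"
        using CB ac c by (simp add: conj_by_fixes_iff)
      ultimately show ?thesis using ac bd c by (simp add: mult_conj_by conj_by_mult)
    qed
    then have "conj_by x y \<otimes> inv y = conj_by a b \<otimes> (conj_by c d \<otimes> inv d \<otimes> inv b)"
      using bd c by (simp add: inv_mult_group m_assoc)
    moreover have cd: "conj_by c d \<otimes> inv d \<in> C"
      using ac bd Csub by (simp add: subgroup_conj_closed subgroup.m_closed subgroup.m_inv_closed)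
    moreover have "inv b \<in> B" using bd B(1) by (simp add: subgroup.m_inv_closed)
    ultimately have "conj_by x y \<otimes> inv y = (conj_by a b \<otimes> inv b) \<otimes> (conj_by c d \<otimes> inv d)"
      using CB c by (simp add: m_assoc)
    then show "conj_by x y \<otimes> inv y \<in> K" using l cd unfolding K_def mem_set_mult_iff by blast
  qed
  then have "K = N" using K hall_parts_commute_imp_whole by blast
  have "B \<subseteq> L"
  proof
    fix b assume b: "b \<in> B"
    then have "b \<otimes> \<one> \<in> K" using B(2) \<open>K = N\<close> Bc by auto
    then show "b \<in> L" using K_cancel b subgroup.one_closed[OF Csub] by blast
  qed
  then show "L = B" using L(2) by blast
qed

lemma elementwise_subnormal_subgroup:
  "elementwise_subnormal \<pi> A \<Longrightarrow> subgroup A G"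
  by (induction rule: elementwise_subnormal.induct) (simp_all add: subgroup_self)

lemma subnormal_Int_normalized:
  assumes "elementwise_subnormal \<pi> A"
  shows "normalizes N (A \<inter> N)"
  using assms
proof induction
  case whole
  then show ?case using N_normalized N_carrier by (auto simp: normalizes_def)
next
  case (step A B L)
  have AN: "subgroup (A \<inter> N) G"
    using elementwise_subnormal_subgroup[OF step.hyps(1)] N_subgroup by (rule subgroups_Inter_pair)
  have LN: "subgroup (L \<inter> N) G" "L \<inter> N \<subseteq> A \<inter> N" "normalizes (A \<inter> N) (L \<inter> N)"
    using step.hyps N_normalized N_carrier subgroups_Inter_pair[OF _ N_subgroup]
    by (auto simp: normalizes_def)
  note L = normal_chain_step[OF AN _ step.IH LN]
  from step.hyps(7) show ?case
  proof
    assume "L = B"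
    then show ?thesis using L(1) by simp
  next
    assume "hall_parts_commute \<pi> A L"
    then have "hall_parts_commute \<pi> (A \<inter> N) (L \<inter> N)"
      using N_subgroup unfolding hall_parts_commute_def
      by (simp add: subgroup_conj_closed subgroup.m_closed subgroup.m_inv_closed) blast
    then have "L \<inter> N = A \<inter> N" using L(2) by simp
    then have "B \<inter> N = L \<inter> N" using step.hyps by blast
    then show ?thesis using L(1) by simp
  qed
qed

text \<open>
  A conjugate of \<open>x \<in> A \<inter> N\<close> by \<open>m \<otimes> n\<close> is an \<open>M\<close>-conjugate of an element of \<open>A \<inter> N\<close>, because \<open>N\<close>
  normalizes \<open>A \<inter> N\<close>. So all conjugates of \<open>x\<close> lie in \<open>M\<close>, which \<open>x \<noteq> \<one>\<close> would force to contain \<open>N\<close>.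
\<close>

lemma subnormal_below_supplement:
  assumes A: "elementwise_subnormal \<pi> A" "A \<subseteq> M" and M: "subgroup M G" "\<not> N \<subseteq> M"
    and G: "\<And>g. g \<in> carrier G \<Longrightarrow> \<exists>m\<in>M. \<exists>n\<in>N. g = m \<otimes> n"
  shows "A \<inter> N = {\<one>}"
proof (rule ccontr)
  assume "A \<inter> N \<noteq> {\<one>}"
  moreover have "\<one> \<in> A \<inter> N"
    using elementwise_subnormal_subgroup[OF A(1)] N_subgroup by (simp add: subgroup.one_closed)
  ultimately obtain x where x: "x \<in> A" "x \<in> N" "x \<noteq> \<one>" by blast
  have "conj_by g x \<in> M" if g: "g \<in> carrier G" for g
  proof -
    obtain m n where mn: "m \<in> M" "n \<in> N" "g = m \<otimes> n" using G g by blast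
    have "conj_by n x \<in> M"
      using subnormal_Int_normalized[OF A(1)] mn x A(2) by (auto simp: normalizes_def)
    then have "conj_by m (conj_by n x) \<in> M" using mn M(1) by (simp add: subgroup_conj_closed)
    then show ?thesis
      using mn x M(1) by (simp add: mult_conj_by N_carrier subgroup.mem_carrier)
  qed
  then have "N \<subseteq> M" by (rule conjugates_in_subgroup[OF minimal M(1) x(2,3)])
  with M(2) show False by simp
qed

end

section \<open>Counting conjugates; Sylow conjugacy and the Frattini argument\<close>

lemma card_image_uniform_fibers:
  assumes "finite A" and "\<And>y. y \<in> f ` A \<Longrightarrow> card {x \<in> A. f x = y} = k"
  shows "card (f ` A) * k = card A"
  using sum.image_gen[OF assms(1), of "\<lambda>_. 1::nat" f] assms(2) by simp

text \<open>
  With \<open>c\<close> the order of a subgroup of a group of order \<open>n\<close> and \<open>k\<close> the number of nonidentity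
  elements in its conjugates, the assumption is the outcome of \<open>card_conjugates\<close> for a
  self-normalizing subgroup that meets its other conjugates trivially.
\<close>

lemma half_le_card:
  fixes k n c :: nat
  assumes "k * c = n * (c - 1)" "2 \<le> c"
  shows "n \<le> 2 * k"
proof -
  have "n * c \<le> n * (2 * (c - 1))" using assms(2) by (intro mult_le_mono2) simp
  also have "\<dots> = (2 * k) * c" using assms(1) by simp
  finally show ?thesis using assms(2) by simp
qed

context group
begin

definition conjugates :: "'a set \<Rightarrow> 'a set \<Rightarrow> 'a set" where
  "conjugates H S = (\<lambda>(g, x). conj_by g x) ` (H \<times> S)"

text \<open>
  The map from pairs \<open>(g, x)\<close> to conjugates has fibres of size \<open>card M\<close>: two pairs with the same
  value differ by an element of \<open>H\<close> that conjugates some element of \<open>S\<close> back into \<open>S\<close>.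
  It is used for \<open>S\<close> the set of nonidentity elements of a subgroup that meets its other
  conjugates trivially, and for \<open>S\<close> a single element.
\<close>

lemma card_conjugates:
  assumes fin: "finite (carrier G)" and H: "subgroup H G" and M: "subgroup M G" "M \<subseteq> H"
    and S: "S \<subseteq> carrier G" "normalizes M S"
    and stab: "\<And>g x. g \<in> H \<Longrightarrow> x \<in> S \<Longrightarrow> conj_by g x \<in> S \<Longrightarrow> g \<in> M"
  shows "card (conjugates H S) * card M = card H * card S"
proof -
  have Hc: "g \<in> carrier G" if "g \<in> H" for g using H that by (rule subgroup.mem_carrier)
  have Mc: "g \<in> carrier G" if "g \<in> M" for g using M(1) that by (rule subgroup.mem_carrier)
  have Sc: "x \<in> carrier G" if "x \<in> S" for x using S(1) that by blast
  have finHS: "finite (H \<times> S)"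
    using fin H S(1) by (metis finite_SigmaI finite_subset subgroup.subset)
  have "card {z \<in> H \<times> S. (\<lambda>(g, x). conj_by g x) z = y} = card M"
    if y: "y \<in> (\<lambda>(g, x). conj_by g x) ` (H \<times> S)" for y
  proof -
    obtain g0 x0 where g0: "g0 \<in> H" "x0 \<in> S" "y = conj_by g0 x0"
      using y by auto
    let ?f = "\<lambda>m. (g0 \<otimes> m, conj_by (inv m) x0)"
    have "{z \<in> H \<times> S. (\<lambda>(g, x). conj_by g x) z = y} = ?f ` M"
    proof (intro equalityI subsetI)
      fix z assume "z \<in> {z \<in> H \<times> S. (\<lambda>(g, x). conj_by g x) z = y}"
      then obtain g x where z: "z = (g, x)" "g \<in> H" "x \<in> S" "conj_by g x = conj_by g0 x0"
        using g0 by auto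
      define m where "m = inv g0 \<otimes> g"
      have mH: "m \<in> H"
        using z g0 H by (simp add: m_def subgroup.m_closed subgroup.m_inv_closed)
      have mx: "conj_by m x = x0"
        using z g0 by (simp add: m_def mult_conj_by Hc Sc)
      then have "m \<in> M" using stab[OF mH z(3)] g0 by simp
      moreover have "g = g0 \<otimes> m" using z g0 by (simp add: m_def Hc flip: m_assoc)
      moreover have "x = conj_by (inv m) x0" using mx mH z by (simp add: Hc Sc flip: mx)
      ultimately show "z \<in> ?f ` M" using z by blast
    next
      fix z assume "z \<in> ?f ` M"
      then obtain m where m: "m \<in> M" "z = (g0 \<otimes> m, conj_by (inv m) x0)" by blast
      have "g0 \<otimes> m \<in> H" using m g0 M H by (simp add: subgroup.m_closed subset_iff)
      moreover have "conj_by (inv m) x0 \<in> S"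
        using S(2) m g0 M by (simp add: normalizes_def subgroup.m_inv_closed)
      moreover have "conj_by (g0 \<otimes> m) (conj_by (inv m) x0) = y"
        using m g0 by (simp add: mult_conj_by Hc Mc Sc)
      ultimately show "z \<in> {z \<in> H \<times> S. (\<lambda>(g, x). conj_by g x) z = y}" using m by simp
    qed
    moreover have "inj_on ?f M"
      using g0 by (auto simp: inj_on_def Hc Mc)
    ultimately show ?thesis by (simp add: card_image)
  qed
  from card_image_uniform_fibers[OF finHS this] show ?thesis
    by (simp add: conjugates_def card_cartesian_product)
qed

lemma conjugates_subset:
  assumes "subgroup H G" "subgroup K G" "H \<subseteq> K" "S \<subseteq> K"
  shows "conjugates H S \<subseteq> K"
  using assms subgroup_conj_closed by (auto simp: conjugates_def subset_iff)

definition conj_stabilizer :: "'a set \<Rightarrow> 'a set" where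
  "conj_stabilizer S = {g \<in> carrier G. conj_by g ` S = S}"

lemma conj_stabilizer_subgroup:
  assumes "S \<subseteq> carrier G"
  shows "subgroup (conj_stabilizer S) G"
proof (rule subgroupI)
  have *: "conj_by (g \<otimes> h) ` S = conj_by g ` conj_by h ` S" if "g \<in> carrier G" "h \<in> carrier G" for g h
    using that assms by (force simp: mult_conj_by image_image subset_iff cong: image_cong)
  show "a \<otimes> b \<in> conj_stabilizer S" if "a \<in> conj_stabilizer S" "b \<in> conj_stabilizer S" for a b
    using that * by (simp add: conj_stabilizer_def)
  have id: "conj_by \<one> ` S = S" using assms by (force simp: subset_iff)
  then show "conj_stabilizer S \<noteq> {}" by (auto simp: conj_stabilizer_def)
  show "inv a \<in> conj_stabilizer S" if "a \<in> conj_stabilizer S" for a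
    using that *[of "inv a" a] id by (auto simp: conj_stabilizer_def)
qed (auto simp: conj_stabilizer_def)

lemma card_double_coset:
  assumes fin: "finite (carrier G)" and P: "subgroup P G" and Q: "subgroup Q G" and x: "x \<in> carrier G"
  shows "card ((\<lambda>(u, v). u \<otimes> x \<otimes> v) ` (Q \<times> P)) * card (Q \<inter> conj_by x ` P) = card Q * card P"
proof -
  have c: "u \<in> carrier G" if "u \<in> Q \<or> u \<in> P" for u
    using that P Q subgroup.mem_carrier by metis
  have finQP: "finite (Q \<times> P)" using fin P Q by (metis finite_SigmaI finite_subset subgroup.subset)
  have "card {z \<in> Q \<times> P. (\<lambda>(u, v). u \<otimes> x \<otimes> v) z = y} = card (Q \<inter> conj_by x ` P)"
    if y: "y \<in> (\<lambda>(u, v). u \<otimes> x \<otimes> v) ` (Q \<times> P)" for y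
  proof -
    obtain u0 v0 where u0: "u0 \<in> Q" "v0 \<in> P" "y = u0 \<otimes> x \<otimes> v0" using y by auto
    let ?f = "\<lambda>w. (u0 \<otimes> w, conj_by (inv x) (inv w) \<otimes> v0)"
    have "{z \<in> Q \<times> P. (\<lambda>(u, v). u \<otimes> x \<otimes> v) z = y} = ?f ` (Q \<inter> conj_by x ` P)"
    proof (intro equalityI subsetI)
      fix z assume "z \<in> {z \<in> Q \<times> P. (\<lambda>(u, v). u \<otimes> x \<otimes> v) z = y}"
      then obtain u v where z: "z = (u, v)" "u \<in> Q" "v \<in> P" "u \<otimes> x \<otimes> v = u0 \<otimes> x \<otimes> v0"
        using u0 by auto
      define w where "w = inv u0 \<otimes> u"
      have cc: "u \<in> carrier G" "v \<in> carrier G" "u0 \<in> carrier G" "v0 \<in> carrier G" using z u0 c by auto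
      have wQ: "w \<in> Q" using z u0 Q by (simp add: w_def subgroup.m_closed subgroup.m_inv_closed)
      have "u \<otimes> x = u0 \<otimes> (x \<otimes> v0 \<otimes> inv v)"
        using z(4) cc x by (metis inv_solve_right m_assoc m_closed inv_closed)
      then have "inv u0 \<otimes> (u \<otimes> x) = x \<otimes> v0 \<otimes> inv v"
        using cc x by (metis inv_solve_left m_closed inv_closed)
      then have "w \<otimes> x = x \<otimes> (v0 \<otimes> inv v)"
        using cc x by (simp add: w_def m_assoc)
      then have w: "w = conj_by x (v0 \<otimes> inv v)"
        using cc x by (metis conj_by_def inv_solve_right m_closed inv_closed w_def)
      moreover have "v0 \<otimes> inv v \<in> P" using z u0 P by (simp add: subgroup.m_closed subgroup.m_inv_closed)
      ultimately have "w \<in> Q \<inter> conj_by x ` P" using wQ by blast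
      moreover have "u = u0 \<otimes> w" using cc by (simp add: w_def flip: m_assoc)
      moreover have "v = conj_by (inv x) (inv w) \<otimes> v0"
        using cc x by (simp add: w inv_mult_group m_assoc flip: conj_by_inv)
      ultimately show "z \<in> ?f ` (Q \<inter> conj_by x ` P)" using z by blast
    next
      fix z assume "z \<in> ?f ` (Q \<inter> conj_by x ` P)"
      then obtain p where w: "p \<in> P" "conj_by x p \<in> Q" "z = ?f (conj_by x p)" by auto
      then have "z = (u0 \<otimes> conj_by x p, inv p \<otimes> v0)" using x c by (simp flip: conj_by_inv)
      moreover have "u0 \<otimes> conj_by x p \<otimes> x \<otimes> (inv p \<otimes> v0) = y"
      proof -
        have "p \<otimes> (inv p \<otimes> v0) = v0" using w u0 c by (simp flip: m_assoc)
        then show ?thesis using u0 w c x by (simp add: conj_by_def m_assoc)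
      qed
      ultimately show "z \<in> {z \<in> Q \<times> P. (\<lambda>(u, v). u \<otimes> x \<otimes> v) z = y}"
        using w u0 P Q by (simp add: subgroup.m_closed subgroup.m_inv_closed)
    qed
    moreover have "inj_on ?f (Q \<inter> conj_by x ` P)" using u0 c by (auto simp: inj_on_def)
    ultimately show ?thesis by (simp add: card_image)
  qed
  from card_image_uniform_fibers[OF finQP this] show ?thesis
    by (simp add: card_cartesian_product)
qed

text \<open>
  The double cosets of \<open>Q\<close> and \<open>P\<close> partition \<open>N\<close>. If \<open>Q\<close> is in no conjugate of \<open>P\<close>, the size of each
  of them is divisible by a higher power of \<open>p\<close> than \<open>card N\<close> is.
\<close>

lemma p_subgroup_in_sylow_conjugate:
  assumes fin: "finite (carrier G)" and p: "Factorial_Ring.prime (p::nat)"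
    and N: "subgroup N G" "\<not> p ^ Suc a dvd card N"
    and P: "subgroup P G" "P \<subseteq> N" "card P = p ^ a"
    and Q: "subgroup Q G" "Q \<subseteq> N" "card Q = p ^ b"
  shows "\<exists>g\<in>N. Q \<subseteq> conj_by g ` P"
proof (rule ccontr)
  assume no: "\<not> (\<exists>g\<in>N. Q \<subseteq> conj_by g ` P)"
  have c: "u \<in> carrier G" if "u \<in> N" for u using that N(1) by (metis subgroup.mem_carrier)
  have PQ: "u \<in> carrier G" if "u \<in> Q \<or> u \<in> P" for u using that P Q c by blast
  define D where "D x = (\<lambda>(u, v). u \<otimes> x \<otimes> v) ` (Q \<times> P)" for x
  have finQ: "finite Q" using fin Q(1) finite_subset subgroup.subset by metis
  have self: "x \<in> D x" if "x \<in> N" for x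
    unfolding D_def using that c subgroup.one_closed[OF P(1)] subgroup.one_closed[OF Q(1)]
    by (auto intro!: image_eqI[of _ _ "(\<one>, \<one>)"])
  have DN: "D x \<subseteq> N" if "x \<in> N" for x
    using that P(2) Q(2) N(1) by (auto simp: D_def intro!: subgroup.m_closed)
  have sub: "D y \<subseteq> D x" if "x \<in> N" "y \<in> D x" for x y
  proof
    fix z assume "z \<in> D y"
    then obtain u v where z: "u \<in> Q" "v \<in> P" "z = u \<otimes> y \<otimes> v" by (auto simp: D_def)
    obtain u' v' where y: "u' \<in> Q" "v' \<in> P" "y = u' \<otimes> x \<otimes> v'"
      using \<open>y \<in> D x\<close> by (auto simp: D_def)
    have "z = (u \<otimes> u') \<otimes> x \<otimes> (v' \<otimes> v)" using z y that c PQ by (simp add: m_assoc)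
    moreover have "u \<otimes> u' \<in> Q" "v' \<otimes> v \<in> P" using z y P Q by (simp_all add: subgroup.m_closed)
    ultimately show "z \<in> D x" unfolding D_def by force
  qed
  have sym: "x \<in> D y" if "x \<in> N" "y \<in> D x" for x y
  proof -
    obtain u v where y: "u \<in> Q" "v \<in> P" "y = u \<otimes> x \<otimes> v"
      using \<open>y \<in> D x\<close> by (auto simp: D_def)
    have "u \<in> carrier G" "v \<in> carrier G" "x \<in> carrier G" using y that c PQ by auto
    then have "x = inv u \<otimes> y \<otimes> inv v"
      using y(3) by (metis inv_closed inv_solve_left' inv_solve_right m_assoc m_closed)
    moreover have "inv u \<in> Q" "inv v \<in> P" using y P Q by (simp_all add: subgroup.m_inv_closed)
    ultimately show ?thesis unfolding D_def by force
  qed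
  have "p ^ Suc a dvd card (D x)" if x: "x \<in> N" for x
  proof -
    let ?W = "Q \<inter> conj_by x ` P"
    have W: "subgroup ?W G"
      using Q(1) P(1) x c by (simp add: subgroups_Inter_pair subgroup_conj_image)
    have "?W \<noteq> Q" using no x by blast
    then have "card ?W < card Q" using finQ by (simp add: psubset_card_mono psubset_eq)
    moreover have "card ?W dvd p ^ b" using card_subgroup_dvd[OF W Q(1)] Q(3) by simp
    then obtain k where k: "card ?W = p ^ k" using p divides_primepow_nat by blast
    ultimately have "p ^ k < p ^ b" using Q(3) by simp
    then have kb: "k < b" using p prime_gt_1_nat power_less_imp_less_exp by blast
    have "card (D x) * p ^ k = p ^ b * p ^ a"
      using card_double_coset[OF fin P(1) Q(1) c[OF x]] k Q(3) P(3) by (simp add: D_def)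
    also have "\<dots> = p ^ (a + (b - k)) * p ^ k" using kb by (simp add: add.commute flip: power_add)
    finally have "card (D x) = p ^ (a + (b - k))" using p prime_gt_0_nat by auto
    then show ?thesis using kb by (simp add: le_imp_power_dvd del: power_Suc)
  qed
  then have "p ^ Suc a dvd card (\<Union> (D ` N))"
  proof (intro dvd_partition)
    show "finite (\<Union> (D ` N))"
      using DN fin N(1) by (meson UN_least finite_subset subgroup.subset)
    have "D x = D y" if xy: "x \<in> N" "y \<in> N" and z: "z \<in> D x" "z \<in> D y" for x y z
    proof -
      have zN: "z \<in> N" using DN xy(1) z(1) by blast
      have "D x = D z" using sub[OF xy(1) z(1)] sub[OF zN sym[OF xy(1) z(1)]] by blast
      moreover have "D y = D z" using sub[OF xy(2) z(2)] sub[OF zN sym[OF xy(2) z(2)]] by blast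
      ultimately show ?thesis by simp
    qed
    then show "\<forall>c1\<in>D ` N. \<forall>c2\<in>D ` N. c1 \<noteq> c2 \<longrightarrow> c1 \<inter> c2 = {}" by blast
  qed auto
  moreover have "\<Union> (D ` N) = N" using self DN by auto
  ultimately show False using N(2) by simp
qed

lemma frattini_argument:
  assumes fin: "finite (carrier G)" and p: "Factorial_Ring.prime (p::nat)"
    and N: "subgroup N G" "normalizes (carrier G) N" "\<not> p ^ Suc a dvd card N"
    and P: "subgroup P G" "P \<subseteq> N" "card P = p ^ a"
    and g: "g \<in> carrier G"
  shows "\<exists>m\<in>conj_stabilizer P. \<exists>n\<in>N. g = m \<otimes> n"
proof -
  have PG: "P \<subseteq> carrier G" and NG: "N \<subseteq> carrier G" using P N by (metis subgroup.subset)+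
  let ?Q = "conj_by (inv g) ` P"
  have Q: "subgroup ?Q G" "card ?Q = p ^ a"
    using P g PG by (simp_all add: subgroup_conj_image card_conj_image)
  moreover have "?Q \<subseteq> N" using P(2) N(2) g by (auto simp: normalizes_def)
  ultimately obtain n where n: "n \<in> N" "?Q \<subseteq> conj_by n ` P"
    using p_subgroup_in_sylow_conjugate[OF fin p N(1,3) P Q(1)] by blast
  have nc: "n \<in> carrier G" using n NG by blast
  have "?Q = conj_by n ` P"
  proof (rule card_subset_eq)
    show "finite (conj_by n ` P)" using fin PG finite_subset by blast
  qed (use n Q P PG nc in \<open>simp_all add: card_conj_image\<close>)
  then have "conj_by g ` ?Q = conj_by (g \<otimes> n) ` P"
    using g nc PG by (force simp: image_image mult_conj_by subset_iff cong: image_cong)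
  moreover have "conj_by g ` ?Q = P"
    using g PG by (force simp: image_image subset_iff cong: image_cong)
  ultimately have "g \<otimes> n \<in> conj_stabilizer P" using g nc by (simp add: conj_stabilizer_def)
  moreover have "g = (g \<otimes> n) \<otimes> inv n" using g nc by (simp add: m_assoc)
  ultimately show ?thesis using n N(1) subgroup.m_inv_closed by metis
qed

section \<open>Maximal subgroups and maximal chains\<close>

lemma maximal_subgroup_iff:
  assumes "subgroup B G"
  shows "maximal_subgroup M (G\<lparr>carrier := B\<rparr>) \<longleftrightarrow>
    subgroup M G \<and> M \<subset> B \<and> (\<forall>H. subgroup H G \<and> M \<subseteq> H \<and> H \<subseteq> B \<longrightarrow> H = M \<or> H = B)"
  using subgroup_in_subgroup_iff[OF assms] by (auto simp: maximal_subgroup_def)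

lemma exists_maximal_subgroup:
  assumes fin: "finite (carrier G)" and A: "subgroup A G" and B: "subgroup B G" and AB: "A \<subset> B"
  shows "\<exists>M. maximal_subgroup M (G\<lparr>carrier := B\<rparr>) \<and> A \<subseteq> M"
proof -
  have finB: "finite B" using fin B finite_subset subgroup.subset by metis
  let ?\<M> = "{M. subgroup M G \<and> A \<subseteq> M \<and> M \<subset> B}"
  have "finite ?\<M>" using finB by (auto intro: finite_subset[of _ "Pow B"])
  moreover have "A \<in> ?\<M>" using A AB by simp
  ultimately have "\<exists>M\<in>?\<M>. A \<subseteq> M \<and> (\<forall>H\<in>?\<M>. M \<subseteq> H \<longrightarrow> M = H)"
    by (rule finite_has_maximal2)
  then obtain M where M: "M \<in> ?\<M>" and max: "\<forall>H\<in>?\<M>. M \<subseteq> H \<longrightarrow> M = H" by (elim bexE conjE)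
  have "H = M \<or> H = B" if H: "subgroup H G" "M \<subseteq> H" "H \<subseteq> B" for H
  proof (cases "H = B")
    case False
    then have "H \<in> ?\<M>" using H M by auto
    then show ?thesis using max H(2) by blast
  qed simp
  then have "maximal_subgroup M (G\<lparr>carrier := B\<rparr>)"
    using M unfolding maximal_subgroup_iff[OF B] by simp
  then show ?thesis using M by auto
qed

lemma maximal_chain_three:
  "maximal_chain G 3 C \<longleftrightarrow> C 0 = carrier G \<and> maximal_subgroup (C 1) (G\<lparr>carrier := C 0\<rparr>) \<and>
     maximal_subgroup (C 2) (G\<lparr>carrier := C 1\<rparr>) \<and> maximal_subgroup (C 3) (G\<lparr>carrier := C 2\<rparr>)"
proof -
  have "{1..3} = {1, 2, 3::nat}" by auto
  then show ?thesis by (simp add: maximal_chain_def)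
qed

end

context mixed_minimal_normal
begin

section \<open>A proper mixed minimal normal subgroup\<close>

text \<open>
  Let \<open>M\<close> be maximal above the normalizer of a Sylow subgroup \<open>P\<close> of \<open>N\<close>, and let \<open>M2\<close> be maximal
  in \<open>M\<close> above \<open>M \<inter> N\<close>. Neither is subnormal, as each meets \<open>N\<close> in \<open>M \<inter> N \<noteq> 1\<close>. So every maximal
  subgroup of \<open>M2\<close> is subnormal and meets \<open>N\<close> trivially. This leaves \<open>M2 = M \<inter> N\<close>, without proper
  nontrivial subgroups, and hence \<open>P = M \<inter> N\<close>.
\<close>

lemma self_normalizing_sylow:
  assumes chains: "\<And>C. maximal_chain G 3 C \<Longrightarrow> \<exists>i\<in>{1..3}. elementwise_subnormal \<pi> (C i)"
    and proper: "N \<noteq> carrier G"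
    and r: "Factorial_Ring.prime r" "r dvd card N"
  shows "\<exists>P a. subgroup P G \<and> P \<subseteq> N \<and> P \<noteq> {\<one>} \<and> card P = r ^ a \<and> conj_stabilizer P \<inter> N \<subseteq> P \<and>
    (\<forall>H. subgroup H G \<and> H \<subset> P \<longrightarrow> H = {\<one>})"
proof -
  have finN: "finite N" using finite_carrier N_subgroup finite_subset subgroup.subset by metis
  define a where "a = multiplicity r (card N)"
  have N0: "card N > 0" using finN subgroup.one_closed[OF N_subgroup] card_gt_0_iff by blast
  have a: "r ^ a dvd card N" "\<not> r ^ Suc a dvd card N" "a > 0"
    using r N0 prime_gt_1_nat[OF r(1)] power_dvd_iff_le_multiplicity[of "card N" r]
    by (auto simp: a_def multiplicity_dvd prime_multiplicity_gt_zero_iff simp del: power_Suc)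
  obtain P where P: "subgroup P G" "P \<subseteq> N" "card P = r ^ a"
  proof -
    interpret GN: group "G\<lparr>carrier := N\<rparr>" by (rule subgroup_imp_group[OF N_subgroup])
    obtain m where "card N = r ^ a * m" using a(1) by blast
    then have "order (G\<lparr>carrier := N\<rparr>) = r ^ a * m" by (simp add: order_def)
    then obtain P where "subgroup P (G\<lparr>carrier := N\<rparr>)" "card P = r ^ a"
      using sylow_thm[OF r(1) GN.is_group] finN by auto
    then show ?thesis using that subgroup_in_subgroup_iff[OF N_subgroup] by blast
  qed
  have P1: "P \<noteq> {\<one>}"
  proof
    assume "P = {\<one>}"
    then have "r ^ a = 1" using P(3) by simp
    then show False using r(1) a(3) by simp
  qed
  have PG: "P \<subseteq> carrier G" using P(1) by (rule subgroup.subset)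
  let ?S = "conj_stabilizer P"
  have S: "subgroup ?S G" by (rule conj_stabilizer_subgroup[OF PG])
  have "?S \<noteq> carrier G"
  proof
    assume "?S = carrier G"
    then have "normalizes (carrier G) P" by (auto simp: conj_stabilizer_def normalizes_def)
    then have "P \<lhd> G" using P(1) by (simp add: normal_iff_normalizes)
    then have "P = N" using minimal P P1 subgroup.one_closed[OF P(1)] by (auto simp: chief_factor_def)
    then have "p dvd r ^ a" "q dvd r ^ a" using p q P(3) by simp_all
    then have "p dvd r" "q dvd r" using p(1) q(1) prime_dvd_power by blast+
    then have "p = r" "q = r" using p(1) q(1) r(1) primes_dvd_imp_eq by blast+
    then show False using p q by simp
  qed
  \<comment> \<open>Maximal chains speak of \<open>G\<lparr>carrier := carrier G\<rparr>\<close>, so the bound is stated in this form.\<close>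
  then obtain M where M: "maximal_subgroup M (G\<lparr>carrier := carrier G\<rparr>)" "?S \<subseteq> M"
    using exists_maximal_subgroup[OF finite_carrier S subgroup_self] subgroup.subset[OF S] by blast
  have M': "subgroup M G" "M \<subset> carrier G"
    using M(1) unfolding maximal_subgroup_iff[OF subgroup_self] by blast+
  have GMN: "\<exists>m\<in>M. \<exists>n\<in>N. g = m \<otimes> n" if "g \<in> carrier G" for g
    using frattini_argument[OF finite_carrier r(1) N_subgroup N_normalized a(2) P that] M(2) by blast
  have NM: "\<not> N \<subseteq> M"
  proof
    assume "N \<subseteq> M"
    then have "g \<in> M" if "g \<in> carrier G" for g
      using GMN[OF that] subgroup.m_closed[OF M'(1)] by blast
    then show False using M'(2) by blast
  qed
  have trivial: "A \<inter> N = {\<one>}" if "elementwise_subnormal \<pi> A" "A \<subseteq> M" for A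
    using subnormal_below_supplement[OF that M'(1) NM GMN] .
  have PM: "P \<subseteq> M"
  proof
    fix x assume x: "x \<in> P"
    have "conj_by x ` P = P"
    proof (rule card_subset_eq)
      show "conj_by x ` P \<subseteq> P" using x P(1) subgroup_conj_closed by blast
      show "card (conj_by x ` P) = card P" using x PG by (intro card_conj_image) auto
      show "finite P" using P(2) finN finite_subset by blast
    qed
    then show "x \<in> M" using x PG M(2) by (auto simp: conj_stabilizer_def)
  qed
  have MN1: "M \<inter> N \<noteq> {\<one>}" using PM P(1,2) P1 subgroup.one_closed by fastforce
  have MN: "subgroup (M \<inter> N) G" using M'(1) N_subgroup by (rule subgroups_Inter_pair)
  have "M \<inter> N \<noteq> M"
  proof
    assume "M \<inter> N = M"
    then have "g \<in> N" if "g \<in> carrier G" for g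
      using GMN[OF that] subgroup.m_closed[OF N_subgroup] by blast
    then show False using proper subgroup.subset[OF N_subgroup] by blast
  qed
  then obtain M2 where M2: "maximal_subgroup M2 (G\<lparr>carrier := M\<rparr>)" "M \<inter> N \<subseteq> M2"
    using exists_maximal_subgroup[OF finite_carrier MN M'(1)] by blast
  have M2': "subgroup M2 G" "M2 \<subseteq> M" using M2(1) by (auto simp: maximal_subgroup_iff[OF M'(1)])
  have below_M2: "H \<inter> N = {\<one>}" if H: "subgroup H G" "H \<subset> M2" for H
  proof -
    obtain M3 where M3: "maximal_subgroup M3 (G\<lparr>carrier := M2\<rparr>)" "H \<subseteq> M3"
      using exists_maximal_subgroup[OF finite_carrier H(1) M2'(1) H(2)] by blast
    have M3': "subgroup M3 G" "M3 \<subseteq> M2" using M3(1) by (auto simp: maximal_subgroup_iff[OF M2'(1)])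
    define C where "C i = [carrier G, M, M2, M3] ! i" for i
    have C: "C 0 = carrier G" "C 1 = M" "C 2 = M2" "C 3 = M3" by (simp_all add: C_def)
    have "maximal_chain G 3 C"
      unfolding maximal_chain_three C using M(1) M2(1) M3(1) by simp
    then obtain i where "i \<in> {1..3}" and i: "elementwise_subnormal \<pi> (C i)" using chains by blast
    then have "i = 1 \<or> i = 2 \<or> i = 3" by auto
    then have "M \<inter> N = {\<one>} \<or> M2 \<inter> N = {\<one>} \<or> M3 \<inter> N = {\<one>}"
      using i C trivial M2' M3' by auto
    moreover have "M2 \<inter> N \<noteq> {\<one>}" using M2 M2' MN1 by blast
    ultimately have "M3 \<inter> N = {\<one>}" using MN1 by blast
    then show ?thesis using M3(2) subgroup.one_closed[OF H(1)] subgroup.one_closed[OF N_subgroup] by blast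
  qed
  have M2N: "M2 = M \<inter> N"
  proof (rule ccontr)
    assume "M2 \<noteq> M \<inter> N"
    then have "M \<inter> N \<inter> N = {\<one>}" using below_M2[OF MN] M2(2) by blast
    then show False using MN1 by (simp add: Int_assoc)
  qed
  have atom: "H = {\<one>}" if "subgroup H G" "H \<subset> M2" for H
    using below_M2[OF that] that M2N by auto
  have PM2: "P = M2" using atom[OF P(1)] P1 PM P(2) M2N by blast
  have "?S \<inter> N \<subseteq> P" using PM2 M2N M(2) by blast
  then show ?thesis using P P1 atom PM2 by blast
qed

text \<open>
  For each of the primes \<open>p\<close> and \<open>q\<close> there is a self-normalizing Sylow subgroup that meets its other
  conjugates trivially, which accounts for at least half of \<open>N\<close>. The two halves are disjoint, since
  the orders of their elements are coprime, and they leave out the identity.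
\<close>

lemma minimal_normal_is_whole:
  assumes chains: "\<And>C. maximal_chain G 3 C \<Longrightarrow> \<exists>i\<in>{1..3}. elementwise_subnormal \<pi> (C i)"
  shows "N = carrier G"
proof (rule ccontr)
  assume proper: "N \<noteq> carrier G"
  have finN: "finite N" using finite_carrier N_subgroup finite_subset subgroup.subset by metis
  have half: "card N \<le> 2 * card (conjugates N (P - {\<one>}))"
    if P: "subgroup P G" "P \<subseteq> N" "P \<noteq> {\<one>}" "conj_stabilizer P \<inter> N \<subseteq> P"
      and atom: "\<forall>H. subgroup H G \<and> H \<subset> P \<longrightarrow> H = {\<one>}" for P
  proof (rule half_le_card)
    have finP: "finite P" using P(2) finN finite_subset by blast
    have PG: "P \<subseteq> carrier G" using P(1) by (rule subgroup.subset)
    have "card (conjugates N (P - {\<one>})) * card P = card N * card (P - {\<one>})"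
    proof (rule card_conjugates[OF finite_carrier N_subgroup P(1,2)])
      show "normalizes P (P - {\<one>})"
        using P(1) PG subgroup_conj_closed by (auto simp: normalizes_def subset_iff)
      fix g x assume g: "g \<in> N" and x: "x \<in> P - {\<one>}" "conj_by g x \<in> P - {\<one>}"
      have gc: "g \<in> carrier G" using g by (rule N_carrier)
      have "conj_by g x \<in> P \<inter> conj_by g ` P" using x by blast
      then have "P \<inter> conj_by g ` P \<noteq> {\<one>}" using x by auto
      moreover have "subgroup (P \<inter> conj_by g ` P) G"
        using P(1) gc by (simp add: subgroups_Inter_pair subgroup_conj_image)
      ultimately have "P \<subseteq> conj_by g ` P" using atom by blast
      then have "P = conj_by g ` P"
        by (rule card_subset_eq[rotated]) (use finP PG gc in \<open>simp_all add: card_conj_image\<close>)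
      then have "g \<in> conj_stabilizer P" using gc by (simp add: conj_stabilizer_def)
      then show "g \<in> P" using P(4) g by blast
    qed (use PG in blast)
    then show "card (conjugates N (P - {\<one>})) * card P = card N * (card P - 1)"
      using finP subgroup.one_closed[OF P(1)] by simp
    show "2 \<le> card P"
    proof (rule ccontr)
      assume "\<not> 2 \<le> card P"
      then have "card P \<le> Suc 0" by simp
      then have "\<forall>x\<in>P. x = \<one>"
        using card_le_Suc0_iff_eq[OF finP] subgroup.one_closed[OF P(1)] by blast
      then show False using P(3) subgroup.one_closed[OF P(1)] by blast
    qed
  qed
  obtain P a where P: "subgroup P G" "P \<subseteq> N" "P \<noteq> {\<one>}" "card P = p ^ a" "conj_stabilizer P \<inter> N \<subseteq> P"
      "\<forall>H. subgroup H G \<and> H \<subset> P \<longrightarrow> H = {\<one>}"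
    using self_normalizing_sylow[OF chains proper p(1,2)] by blast
  obtain Q b where Q: "subgroup Q G" "Q \<subseteq> N" "Q \<noteq> {\<one>}" "card Q = q ^ b" "conj_stabilizer Q \<inter> N \<subseteq> Q"
      "\<forall>H. subgroup H G \<and> H \<subset> Q \<longrightarrow> H = {\<one>}"
    using self_normalizing_sylow[OF chains proper q(1,2)] by blast
  let ?A = "conjugates N (P - {\<one>})" and ?B = "conjugates N (Q - {\<one>})"
  have conj_pow: "x \<in> carrier G" "x \<noteq> \<one>" "x [^] card R = \<one>"
    if "x \<in> conjugates N (R - {\<one>})" "subgroup R G" for x R
    using that subgroup_pow_card[OF finite_carrier that(2)]
    by (auto simp: conjugates_def N_carrier subgroup.mem_carrier simp flip: conj_by_pow)
  have "p \<noteq> q" using p q by blast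
  then have cop: "coprime (p ^ a) (q ^ b)" using p q by (simp add: primes_coprime)
  have AB: "?A \<inter> ?B = {}"
  proof (rule ccontr)
    assume "?A \<inter> ?B \<noteq> {}"
    then obtain x where "x \<in> ?A" "x \<in> ?B" by blast
    then have "x \<in> carrier G" "x \<noteq> \<one>" "x [^] (p ^ a) = \<one>" "x [^] (q ^ b) = \<one>"
      using conj_pow P(1,4) Q(1,4) by metis+
    then show False using coprime_powers_eq_one cop by blast
  qed
  have sub: "?A \<union> ?B \<subseteq> N - {\<one>}"
  proof -
    have "?A \<subseteq> N" "?B \<subseteq> N"
      using conjugates_subset[OF N_subgroup N_subgroup subset_refl] P(2) Q(2) by blast+
    moreover have "\<one> \<notin> ?A" "\<one> \<notin> ?B" using conj_pow P(1) Q(1) by blast+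
    ultimately show ?thesis by blast
  qed
  have fin: "finite ?A" "finite ?B" using sub finN finite_subset by blast+
  have "card N \<le> card ?A + card ?B"
    using half[OF P(1-3,5,6)] half[OF Q(1-3,5,6)] by simp
  also have "\<dots> = card (?A \<union> ?B)" using fin AB by (simp add: card_Un_disjoint)
  also have "\<dots> \<le> card (N - {\<one>})" using sub finN by (intro card_mono) auto
  also have "\<dots> < card N"
    using finN subgroup.one_closed[OF N_subgroup] by (rule card_Diff1_less)
  finally show False by simp
qed

end

section \<open>Simple groups without long subgroup chains\<close>

text \<open>
  A simple group with trivial centre in which no chain \<open>1 \<subset> U \<subset> V \<subset> W \<subset> G\<close> of subgroups
  exists. Counting elements by their centralizers will show that there is no such group.
\<close>

locale short_simple_group = group +
  assumes finite_carrier: "finite (carrier G)"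
    and nontrivial: "carrier G \<noteq> {\<one>}"
    and simple: "L \<lhd> G \<Longrightarrow> L = {\<one>} \<or> L = carrier G"
    and centerless: "z \<in> centralizer (carrier G) \<Longrightarrow> z = \<one>"
    and short: "subgroup U G \<Longrightarrow> subgroup V G \<Longrightarrow> subgroup W G \<Longrightarrow>
      U \<subset> V \<Longrightarrow> V \<subset> W \<Longrightarrow> W \<subset> carrier G \<Longrightarrow> U = {\<one>}"
begin

abbreviation cent :: "'a \<Rightarrow> 'a set" where "cent x \<equiv> centralizer {x}"
abbreviation norm_cent :: "'a \<Rightarrow> 'a set" where "norm_cent x \<equiv> conj_stabilizer (cent x)"
abbreviation cent_class :: "'a \<Rightarrow> 'a set" where
  "cent_class x \<equiv> conjugates (carrier G) (cent x - {\<one>})"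

lemma mem_cent_iff: "y \<in> cent x \<longleftrightarrow> y \<in> carrier G \<and> y \<otimes> x = x \<otimes> y"
  by (simp add: centralizer_def)

lemma cent_subgroup: "x \<in> carrier G \<Longrightarrow> subgroup (cent x) G"
  by (simp add: centralizer_subgroup)

lemma cent_carrier: "cent x \<subseteq> carrier G"
  by (auto simp: centralizer_def)

lemma finite_subset_carrier: "S \<subseteq> carrier G \<Longrightarrow> finite S"
  using finite_carrier finite_subset by blast

lemma cent_proper:
  assumes "x \<in> carrier G" "x \<noteq> \<one>"
  shows "cent x \<subset> carrier G"
proof -
  have "cent x \<noteq> carrier G"
  proof
    assume eq: "cent x = carrier G"
    have "s \<otimes> x = x \<otimes> s" if "s \<in> carrier G" for s
      using that eq mem_cent_iff by blast
    then have "x \<in> centralizer (carrier G)" using assms(1) by (simp add: centralizer_def)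
    then show False using centerless assms(2) by blast
  qed
  then show ?thesis using cent_carrier by blast
qed

text \<open>
  If \<open>y, z\<close> in \<open>cent x\<close> do not commute, the centre of \<open>cent x\<close>, the subgroup \<open>cent x \<inter> cent y\<close> and
  \<open>cent x\<close> form a strict chain of proper subgroups whose smallest member contains \<open>x\<close>.
\<close>

lemma cent_commutes:
  assumes x: "x \<in> carrier G" "x \<noteq> \<one>" and yz: "y \<in> cent x" "z \<in> cent x"
  shows "y \<otimes> z = z \<otimes> y"
proof (rule ccontr)
  assume nc: "y \<otimes> z \<noteq> z \<otimes> y"
  have c: "y \<in> carrier G" "z \<in> carrier G" using yz cent_carrier by blast+
  let ?Z = "cent x \<inter> centralizer (cent x)"
  have sub: "subgroup ?Z G" "subgroup (cent x \<inter> cent y) G"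
    using x c by (simp_all add: subgroups_Inter_pair cent_subgroup centralizer_subgroup[OF cent_carrier])
  have "?Z \<subset> cent x \<inter> cent y"
  proof
    show "?Z \<subseteq> cent x \<inter> cent y" using yz by (auto simp: centralizer_def)
    have "y \<notin> ?Z" using nc yz by (auto simp: centralizer_def)
    moreover have "y \<in> cent x \<inter> cent y" using yz c by (simp add: mem_cent_iff)
    ultimately show "?Z \<noteq> cent x \<inter> cent y" by blast
  qed
  moreover have "z \<notin> cent y" using nc by (simp add: mem_cent_iff)
  then have "cent x \<inter> cent y \<subset> cent x" using yz by blast
  ultimately have "?Z = {\<one>}"
    by (rule short[OF sub cent_subgroup[OF x(1)] _ _ cent_proper[OF x]])
  moreover have "x \<in> ?Z" using x by (auto simp: centralizer_def)
  ultimately show False using x by blast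
qed

text \<open>
  So commuting is an equivalence relation on nonidentity elements, and the centralizers
  partition \<open>G\<close> apart from the identity.
\<close>

lemma cent_eq:
  assumes x: "x \<in> carrier G" "x \<noteq> \<one>" and y: "y \<in> cent x" "y \<noteq> \<one>"
  shows "cent y = cent x"
proof -
  have yc: "y \<in> carrier G" and xy: "x \<in> cent y" using y x by (auto simp: mem_cent_iff)
  show ?thesis
  proof (intro equalityI subsetI)
    fix u assume "u \<in> cent y"
    then show "u \<in> cent x"
      using cent_commutes[OF yc y(2), of u x] xy cent_carrier by (auto simp: mem_cent_iff)
  next
    fix u assume "u \<in> cent x"
    then show "u \<in> cent y"
      using cent_commutes[OF x, of u y] y cent_carrier by (auto simp: mem_cent_iff)
  qed
qed

lemma cent_conj:
  assumes "g \<in> carrier G" "x \<in> carrier G"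
  shows "cent (conj_by g x) = conj_by g ` cent x"
proof (intro equalityI subsetI)
  fix u assume u: "u \<in> cent (conj_by g x)"
  then have "conj_by (inv g) u \<in> cent x"
    using assms conj_by_commute_iff[of g "conj_by (inv g) u" x] by (simp add: mem_cent_iff)
  then have "conj_by g (conj_by (inv g) u) \<in> conj_by g ` cent x" by blast
  then show "u \<in> conj_by g ` cent x" using assms u by (simp add: mem_cent_iff)
qed (use assms in \<open>auto simp: mem_cent_iff conj_by_commute_iff\<close>)

lemma norm_cent_subgroup: "subgroup (norm_cent x) G"
  by (rule conj_stabilizer_subgroup[OF cent_carrier])

lemma cent_subset_norm_cent:
  assumes "x \<in> carrier G" "x \<noteq> \<one>"
  shows "cent x \<subseteq> norm_cent x"
proof
  fix g assume g: "g \<in> cent x"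
  then have gc: "g \<in> carrier G" by (simp add: mem_cent_iff)
  then have "conj_by g x = x" using g assms by (simp add: conj_by_fixes_iff mem_cent_iff)
  then show "g \<in> norm_cent x" using cent_conj[OF gc assms(1)] gc by (simp add: conj_stabilizer_def)
qed

lemma norm_cent_proper:
  assumes x: "x \<in> carrier G" "x \<noteq> \<one>"
  shows "norm_cent x \<subset> carrier G"
proof (rule ccontr)
  assume "\<not> norm_cent x \<subset> carrier G"
  then have "norm_cent x = carrier G" using subgroup.subset[OF norm_cent_subgroup] by blast
  then have "normalizes (carrier G) (cent x)" by (auto simp: conj_stabilizer_def normalizes_def)
  then have "cent x \<lhd> G" using x by (simp add: normal_iff_normalizes cent_subgroup)
  then have "cent x = {\<one>} \<or> cent x = carrier G" by (rule simple)
  moreover have "x \<in> cent x" using x by (simp add: mem_cent_iff)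
  ultimately show False using cent_proper[OF x] x by blast
qed

lemma card_cent_class:
  assumes x: "x \<in> carrier G" "x \<noteq> \<one>"
  shows "card (cent_class x) * card (norm_cent x) = order G * (card (cent x) - 1)"
proof -
  have "card (cent_class x) * card (norm_cent x) = card (carrier G) * card (cent x - {\<one>})"
  proof (rule card_conjugates[OF finite_carrier subgroup_self norm_cent_subgroup])
    show "normalizes (norm_cent x) (cent x - {\<one>})"
      unfolding normalizes_def conj_stabilizer_def using cent_carrier[of x] by fastforce
    fix g u assume g: "g \<in> carrier G" and u: "u \<in> cent x - {\<one>}" "conj_by g u \<in> cent x - {\<one>}"
    have uc: "u \<in> carrier G" using u by (simp add: mem_cent_iff)
    have "cent u = cent x" "cent (conj_by g u) = cent x" using u cent_eq[OF x] by auto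
    then have "conj_by g ` cent x = cent x" using cent_conj[OF g uc] by simp
    then show "g \<in> norm_cent x" using g by (simp add: conj_stabilizer_def)
  qed (use cent_carrier norm_cent_subgroup subgroup.subset in blast)+
  then show ?thesis
    using finite_subset_carrier[OF cent_carrier] subgroup.one_closed[OF cent_subgroup[OF x(1)]]
    by (simp add: order_def)
qed

lemma self_in_cent_class: "x \<in> carrier G \<Longrightarrow> x \<noteq> \<one> \<Longrightarrow> x \<in> cent_class x"
  unfolding conjugates_def
  by (rule image_eqI[of _ _ "(\<one>, x)"]) (auto simp: mem_cent_iff)

lemma cent_class_subset: "x \<in> carrier G \<Longrightarrow> cent_class x \<subseteq> carrier G - {\<one>}"
  by (auto simp: conjugates_def mem_cent_iff)

lemma cent_class_disjoint:
  assumes x: "x \<in> carrier G" "x \<noteq> \<one>" and y: "y \<in> carrier G" "y \<noteq> \<one>" "y \<notin> cent_class x"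
  shows "cent_class x \<inter> cent_class y = {}"
proof (rule ccontr)
  assume "cent_class x \<inter> cent_class y \<noteq> {}"
  then obtain g u h v where g: "g \<in> carrier G" "u \<in> cent x" "u \<noteq> \<one>"
    and h: "h \<in> carrier G" "v \<in> cent y" "v \<noteq> \<one>" and eq: "conj_by g u = conj_by h v"
    by (auto simp: conjugates_def)
  have c: "u \<in> carrier G" "v \<in> carrier G" using g h by (simp_all add: mem_cent_iff)
  have "conj_by g ` cent x = conj_by h ` cent y"
    using cent_conj[OF g(1) c(1)] cent_conj[OF h(1) c(2)] eq cent_eq[OF x g(2,3)] cent_eq[OF y(1,2) h(2,3)]
    by simp
  moreover have "y \<in> cent y" using y by (simp add: mem_cent_iff)
  ultimately obtain w where w: "w \<in> cent x" "conj_by h y = conj_by g w" by blast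
  have wc: "w \<in> carrier G" using w by (simp add: mem_cent_iff)
  have "y = conj_by (inv h) (conj_by g w)" using w(2) h y by (simp flip: w(2))
  then have yw: "y = conj_by (inv h \<otimes> g) w" using g h wc by (simp add: mult_conj_by)
  moreover have "w \<noteq> \<one>" using yw y g h by auto
  ultimately have "y \<in> cent_class x"
    using g h w unfolding conjugates_def by (intro image_eqI[of _ _ "(inv h \<otimes> g, w)"]) auto
  then show False using y by simp
qed

lemma prime_order_in_cent_class:
  assumes "x \<in> carrier G" "z \<in> cent_class x" "Factorial_Ring.prime k" "z [^] (k::nat) = \<one>"
  shows "k dvd card (cent x)"
proof (rule ccontr)
  assume "\<not> k dvd card (cent x)"
  then have cop: "coprime k (card (cent x))" using assms(3) prime_imp_coprime by blast
  obtain g u where g: "g \<in> carrier G" "u \<in> cent x" "u \<noteq> \<one>" "z = conj_by g u"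
    using assms(2) by (auto simp: conjugates_def)
  have uc: "u \<in> carrier G" using g by (simp add: mem_cent_iff)
  have "u [^] k = \<one>" using assms(4) g uc by (simp flip: conj_by_pow)
  moreover have "u [^] card (cent x) = \<one>"
    using subgroup_pow_card[OF finite_carrier cent_subgroup[OF assms(1)] g(2)] .
  ultimately show False using coprime_powers_eq_one uc cop g(3) by blast
qed

text \<open>
  The case of a centralizer \<open>C\<close> that is smaller than its normalizer \<open>M\<close>. As \<open>C \<subset> M \<subset> G\<close>, shortness
  leaves no proper nontrivial subgroup in \<open>C\<close>, so \<open>C\<close> has prime order \<open>r\<close>. The index \<open>k\<close> of \<open>C\<close> in \<open>M\<close>
  is the number of \<open>M\<close>-conjugates of \<open>x\<close>, which lie among the \<open>r - 1\<close> nonidentity elements of \<open>C\<close>.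
  The index is prime because there is no subgroup strictly between \<open>C\<close> and \<open>M\<close>.
\<close>

lemma normalized_cent:
  assumes x: "x \<in> carrier G" "x \<noteq> \<one>" and ne: "norm_cent x \<noteq> cent x"
  obtains k z where "Factorial_Ring.prime (card (cent x))" "Factorial_Ring.prime k"
    "k < card (cent x)" "card (norm_cent x) = k * card (cent x)"
    "z \<in> carrier G" "z \<noteq> \<one>" "z [^] k = \<one>"
proof -
  let ?C = "cent x" and ?M = "norm_cent x"
  have C: "subgroup ?C G" and M: "subgroup ?M G" and CM: "?C \<subset> ?M" and MG: "?M \<subset> carrier G"
    using x ne cent_subgroup norm_cent_subgroup cent_subset_norm_cent norm_cent_proper by auto
  have xC: "x \<in> ?C" using x by (simp add: mem_cent_iff)
  have finC: "finite ?C" and finM: "finite ?M" using finite_subset_carrier cent_carrier MG by auto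
  have C1: "card ?C \<noteq> 1"
  proof
    assume "card ?C = 1"
    then obtain c where "?C = {c}" by (rule card_1_singletonE)
    then show False using xC x subgroup.one_closed[OF C] by auto
  qed
  then obtain r where r: "Factorial_Ring.prime r" "r dvd card ?C" using prime_factor_nat by blast
  obtain P where P: "subgroup P G" "P \<subseteq> ?C" "card P = r"
    using exists_order_p_subgroup[OF finite_carrier C r] by blast
  have "P = ?C"
  proof (rule ccontr)
    assume "P \<noteq> ?C"
    then have "P = {\<one>}" using short[OF P(1) C M _ CM MG] P(2) by blast
    then show False using P(3) r(1) by auto
  qed
  then have cardC: "card ?C = r" using P by simp
  define k0 where "k0 = card (conjugates ?M {x})"
  have k0: "k0 * r = card ?M"
  proof -
    have "k0 * card ?C = card ?M * card {x}"
      unfolding k0_def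
    proof (rule card_conjugates[OF finite_carrier M C])
      show "normalizes ?C {x}"
        using x by (simp add: normalizes_def mem_cent_iff conj_by_fixes_iff)
      show "g \<in> ?C" if "g \<in> ?M" "y \<in> {x}" "conj_by g y \<in> {x}" for g y
        using that x by (simp add: conj_stabilizer_def mem_cent_iff conj_by_fixes_iff)
    qed (use x CM in auto)
    then show ?thesis using cardC by simp
  qed
  have "conjugates ?M {x} \<subseteq> ?C - {\<one>}"
    using xC x by (auto simp: conjugates_def conj_stabilizer_def)
  then have "k0 \<le> card (?C - {\<one>})" unfolding k0_def using finC by (intro card_mono) auto
  also have "\<dots> < r" using cardC finC subgroup.one_closed[OF C] card_Diff1_less by metis
  finally have k0r: "k0 < r" .
  have "card ?C < card ?M" using finM CM by (rule psubset_card_mono)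
  then have "k0 \<noteq> 0" and "k0 \<noteq> 1" using k0 cardC by (metis mult_0 not_less0, fastforce)
  obtain k where k: "Factorial_Ring.prime k" "k dvd k0" using prime_factor_nat[OF \<open>k0 \<noteq> 1\<close>] by blast
  have kk0: "k \<le> k0" using k \<open>k0 \<noteq> 0\<close> by (simp add: dvd_imp_le)
  have "k dvd card ?M" using k k0 by (metis dvd_mult2)
  then obtain Z where Z: "subgroup Z G" "Z \<subseteq> ?M" "card Z = k"
    using exists_order_p_subgroup[OF finite_carrier M k(1)] by blast
  have nM: "normalizes ?M ?C" by (auto simp: normalizes_def conj_stabilizer_def)
  have CZ: "subgroup (?C <#> Z) G" "?C <#> Z \<subseteq> ?M"
    using product_subgroup[OF M C _ nM Z(1,2)] CM by auto
  have sub: "?C \<subseteq> ?C <#> Z" "Z \<subseteq> ?C <#> Z"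
  proof -
    have "c = c \<otimes> \<one>" if "c \<in> ?C" for c using that by (simp add: mem_cent_iff)
    moreover have "c = \<one> \<otimes> c" if "c \<in> Z" for c using that subgroup.mem_carrier[OF Z(1)] by simp
    ultimately show "?C \<subseteq> ?C <#> Z" "Z \<subseteq> ?C <#> Z"
      using subgroup.one_closed[OF C] subgroup.one_closed[OF Z(1)]
      unfolding subset_iff mem_set_mult_iff by blast+
  qed
  \<comment> \<open>The product has order at most \<open>r * k\<close>, so once it is all of \<open>M\<close> the prime factor \<open>k\<close> of \<open>k0\<close>
    is \<open>k0\<close> itself.\<close>
  have "?C <#> Z \<noteq> ?C"
  proof
    assume "?C <#> Z = ?C"
    then have "k dvd r" using sub(2) card_subgroup_dvd[OF Z(1) C] Z(3) cardC by simp
    then have "k = r" using primes_dvd_imp_eq k(1) r(1) by blast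
    then show False using kk0 k0r by simp
  qed
  then have "?C \<subset> ?C <#> Z" using sub by blast
  then have "?C <#> Z = ?M"
    using short[OF C CZ(1) M _ _ MG] CZ(2) xC x by blast
  moreover have "card (?C <#> Z) \<le> card ?C * card Z"
  proof -
    have "?C <#> Z = (\<lambda>(c, z). c \<otimes> z) ` (?C \<times> Z)" by (auto simp: set_mult_def)
    moreover have "finite (?C \<times> Z)" using finC finM Z(2) finite_subset by blast
    ultimately show ?thesis
      using card_image_le[of "?C \<times> Z" "\<lambda>(c, z). c \<otimes> z"] by (simp add: card_cartesian_product)
  qed
  ultimately have "k0 * r \<le> k * r" using k0 cardC Z(3) by (simp add: mult.commute)
  then have "k0 = k" using kk0 r(1) prime_gt_0_nat by (simp add: le_antisym)
  moreover obtain z where "z \<in> Z" "z \<noteq> \<one>"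
  proof -
    have "Z \<noteq> {\<one>}" using Z(3) k(1) by auto
    then show ?thesis using that subgroup.one_closed[OF Z(1)] by blast
  qed
  ultimately show ?thesis
    using that[of k z] r(1) k(1) k0r k0 cardC subgroup_pow_card[OF finite_carrier Z(1)] Z(3)
      subgroup.mem_carrier[OF Z(1)] by simp
qed

lemma card_two_classes:
  assumes "x \<in> carrier G" "x \<noteq> \<one>" "y \<in> carrier G" "y \<noteq> \<one>" "y \<notin> cent_class x"
  shows "card (cent_class x) + card (cent_class y) = card (cent_class x \<union> cent_class y)"
    and "card (cent_class x \<union> cent_class y) < order G"
proof -
  have sub: "cent_class x \<union> cent_class y \<subseteq> carrier G - {\<one>}"
    using cent_class_subset assms by blast
  then have "finite (cent_class x)" "finite (cent_class y)"
    using finite_carrier by (auto intro: finite_subset)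
  then show "card (cent_class x) + card (cent_class y) = card (cent_class x \<union> cent_class y)"
    using cent_class_disjoint[OF assms] by (simp add: card_Un_disjoint)
  have "card (cent_class x \<union> cent_class y) \<le> card (carrier G - {\<one>})"
    using sub finite_carrier by (intro card_mono) auto
  also have "\<dots> < order G"
    unfolding order_def using finite_carrier one_closed by (rule card_Diff1_less)
  finally show "card (cent_class x \<union> cent_class y) < order G" .
qed

lemma two_le_card_cent:
  assumes "x \<in> carrier G" "x \<noteq> \<one>"
  shows "2 \<le> card (cent x)"
proof -
  have "{\<one>, x} \<subseteq> cent x" using assms by (auto simp: mem_cent_iff)
  then have "card {\<one>, x} \<le> card (cent x)"
    by (rule card_mono[OF finite_subset_carrier[OF cent_carrier]])
  then show ?thesis using assms by simp
qed

text \<open>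
  Two disjoint classes of self-normalizing centralizers would each contain half of \<open>G\<close>.
\<close>

lemma self_normalizing_cent_unique:
  assumes x: "x \<in> carrier G" "x \<noteq> \<one>" "norm_cent x = cent x"
    and y: "y \<in> carrier G" "y \<noteq> \<one>" "y \<notin> cent_class x"
  shows "norm_cent y \<noteq> cent y"
proof
  assume "norm_cent y = cent y"
  then have "order G \<le> 2 * card (cent_class x)" "order G \<le> 2 * card (cent_class y)"
    using half_le_card card_cent_class x y two_le_card_cent by metis+
  then show False using card_two_classes[OF x(1,2) y] by simp
qed

text \<open>
  Take \<open>x\<close> of order the smallest prime \<open>p\<close> that divides the order of \<open>G\<close>. If \<open>cent x\<close> were smaller
  than its normalizer, it would have order \<open>p\<close> and prime index below \<open>p\<close> in its normalizer.
\<close>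

lemma exists_self_normalizing_cent: "\<exists>x\<in>carrier G. x \<noteq> \<one> \<and> norm_cent x = cent x"
proof -
  have "order G \<noteq> 1" using nontrivial order_one_triv_iff by simp
  then have ex: "\<exists>p. Factorial_Ring.prime p \<and> p dvd order G" using prime_factor_nat by blast
  define p where "p = (LEAST p. Factorial_Ring.prime p \<and> p dvd order G)"
  have p: "Factorial_Ring.prime p" "p dvd order G"
    using LeastI_ex[OF ex] by (simp_all add: p_def)
  have least: "p \<le> k" if "Factorial_Ring.prime k" "k dvd order G" for k
    unfolding p_def using that by (intro Least_le) simp
  obtain x where x: "x \<in> carrier G" "x \<noteq> \<one>" "x [^] p = \<one>"
    using cauchy_in_subgroup[OF finite_carrier subgroup_self p(1)] p(2) by (auto simp: order_def)
  have "norm_cent x = cent x"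
  proof (rule ccontr)
    assume "norm_cent x \<noteq> cent x"
    then obtain k z where k: "Factorial_Ring.prime (card (cent x))" "Factorial_Ring.prime k"
      "k < card (cent x)" "card (norm_cent x) = k * card (cent x)"
      using normalized_cent[OF x(1,2)] by blast
    have "x \<in> cent x" using x by (simp add: mem_cent_iff)
    then have "x [^] card (cent x) = \<one>"
      using subgroup_pow_card[OF finite_carrier cent_subgroup[OF x(1)]] by blast
    then have "\<not> coprime p (card (cent x))" using coprime_powers_eq_one x by blast
    then have "card (cent x) = p" using primes_coprime p(1) k(1) by blast
    moreover have "k dvd order G"
      using card_subgroup_dvd[OF norm_cent_subgroup subgroup_self] norm_cent_subgroup k(4)
      by (metis dvd_mult_left order_def subgroup.subset)
    ultimately show False using least[OF k(2)] k(3) by simp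
  qed
  then show ?thesis using x by blast
qed

text \<open>
  Choose \<open>y\<close> in \<open>S\<close> with the smallest centralizer, of prime order \<open>r\<close>, say. The prime index \<open>k\<close> of
  \<open>cent y\<close> in its normalizer is smaller than \<open>r\<close>, and an element \<open>z\<close> of order \<open>k\<close> that belonged
  to \<open>S\<close> would have a centralizer of order \<open>k\<close>. So \<open>z\<close> lies outside of \<open>S\<close>.
\<close>

lemma minimal_order_in_class_complement:
  assumes x: "x \<in> carrier G" "x \<noteq> \<one>" "norm_cent x = cent x"
    and S: "S \<subseteq> carrier G - {\<one>}" "cent_class x \<inter> S = {}" "S \<noteq> {}"
  obtains y k z where "y \<in> S" "Factorial_Ring.prime (card (cent y))" "Factorial_Ring.prime k"
    "k < card (cent y)" "card (norm_cent y) = k * card (cent y)"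
    "z \<in> carrier G" "z \<noteq> \<one>" "z [^] k = \<one>" "z \<notin> S"
proof -
  obtain y where y: "y \<in> S" "\<And>w. w \<in> S \<Longrightarrow> card (cent y) \<le> card (cent w)"
    using ex_has_least_nat[of "\<lambda>y. y \<in> S" _ "\<lambda>y. card (cent y)"] S(3) by blast
  have nself: "norm_cent w \<noteq> cent w" if "w \<in> S" for w
    using self_normalizing_cent_unique[OF x, of w] that S by blast
  have yc: "y \<in> carrier G" "y \<noteq> \<one>" using y S by blast+
  obtain k z where k: "Factorial_Ring.prime (card (cent y))" "Factorial_Ring.prime k"
    "k < card (cent y)" "card (norm_cent y) = k * card (cent y)"
    and z: "z \<in> carrier G" "z \<noteq> \<one>" "z [^] k = \<one>"
    using normalized_cent[OF yc nself[OF y(1)]] by blast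
  have "z \<notin> S"
  proof
    assume zS: "z \<in> S"
    then have "Factorial_Ring.prime (card (cent z))"
      using normalized_cent[OF z(1,2) nself[OF zS]] by blast
    moreover have "k dvd card (cent z)"
      using prime_order_in_cent_class[OF z(1) self_in_cent_class[OF z(1,2)] k(2) z(3)] .
    ultimately have "card (cent z) = k" using k(2) primes_dvd_imp_eq by metis
    then show False using y(2)[OF zS] k(3) by simp
  qed
  then show ?thesis using that y(1) k z by blast
qed

text \<open>
  A class of centralizers of order \<open>c\<close> and index \<open>k\<close> in their normalizers contributes
  \<open>n * (c - 1) / (c * k)\<close> elements, where \<open>n\<close> is the order of \<open>G\<close>. Exactly one class has \<open>k = 1\<close>, that
  of \<open>x\<close>, with \<open>c = a\<close>; it misses only \<open>n / a\<close> elements. The smallest remaining centralizer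
  has a prime order \<open>r\<close> and an index \<open>k\<close> dividing \<open>a\<close>, and there is room for it only if \<open>k = a\<close>. Then
  \<open>n / (a * r)\<close> elements are left, counting the identity. If these are the identity
  alone, the normalizer of \<open>cent y\<close> is all of \<open>G\<close>. Otherwise a next smallest centralizer, of
  order \<open>s\<close> with an index \<open>l\<close> that divides \<open>a\<close> or \<open>r\<close>, contains too many elements.
\<close>

lemma no_such_group: False
proof -
  obtain x where x: "x \<in> carrier G" "x \<noteq> \<one>" and nx: "norm_cent x = cent x"
    using exists_self_normalizing_cent by blast
  define n a where "n = order G" and "a = card (cent x)"
  have n0: "n > 0" using finite_carrier by (simp add: n_def order_gt_0_iff_finite)
  have a2: "2 \<le> a" using two_le_card_cent x by (simp add: a_def)
  have Kx: "card (cent_class x) * a = n * (a - 1)"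
    using card_cent_class[OF x] nx by (simp add: n_def a_def)
  define S where "S = carrier G - {\<one>} - cent_class x"
  have "S \<noteq> {}"
  proof
    assume "S = {}"
    then have "cent_class x = carrier G - {\<one>}"
      using cent_class_subset[OF x(1)] by (auto simp: S_def)
    then have "card (cent_class x) = n - 1"
      using finite_carrier by (simp add: n_def order_def)
    then have "(n - 1) * a = n * (a - 1)" using Kx by simp
    then have "n = a" using n0 a2 by (cases n; cases a) auto
    moreover have "a < n"
      unfolding a_def n_def order_def using finite_carrier cent_proper[OF x] by (rule psubset_card_mono)
    ultimately show False by simp
  qed
  have S: "S \<subseteq> carrier G - {\<one>}" "cent_class x \<inter> S = {}" by (auto simp: S_def)
  obtain y k z where yS: "y \<in> S" and "Factorial_Ring.prime (card (cent y))"
    and k: "Factorial_Ring.prime k" "k < card (cent y)" "card (norm_cent y) = k * card (cent y)"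
    and z: "z \<in> carrier G" "z \<noteq> \<one>" "z [^] k = \<one>" "z \<notin> S"
    by (rule minimal_order_in_class_complement[OF x nx S \<open>S \<noteq> {}\<close>])
  have y: "y \<in> carrier G" "y \<noteq> \<one>" "y \<notin> cent_class x" using yS by (auto simp: S_def)
  define r where "r = card (cent y)"
  have k2: "2 \<le> k" using k(1) by (rule prime_ge_2_nat)
  then have r3: "3 \<le> r" using k(2) by (simp add: r_def)
  have Ky: "card (cent_class y) * (k * r) = n * (r - 1)"
    using card_cent_class[OF y(1,2)] k(3) by (simp add: n_def r_def)
  have "z \<in> cent_class x" using z by (simp add: S_def)
  then have "k dvd a" using prime_order_in_cent_class[OF x(1) _ k(1) z(3)] by (simp add: a_def)
  then obtain j where j: "a = k * j" by blast
  have sum: "card (cent_class x) + card (cent_class y) < n"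
    using card_two_classes[OF x y] by (simp add: n_def)
  \<comment> \<open>Clearing denominators in \<open>n * (a - 1) / a + n * (r - 1) / (k * r) < n\<close>.\<close>
  have ineq: "(r - 1) * a < r * k"
  proof -
    have "(card (cent_class x) + card (cent_class y)) * (a * k * r) < n * (a * k * r)"
      using sum a2 k2 r3 by simp
    also have "(card (cent_class x) + card (cent_class y)) * (a * k * r)
        = (card (cent_class x) * a) * (k * r) + (card (cent_class y) * (k * r)) * a"
      by (simp add: algebra_simps)
    also have "\<dots> = n * ((a - 1) * (k * r) + (r - 1) * a)"
      unfolding Kx Ky by (simp add: algebra_simps)
    finally have "(a - 1) * (k * r) + (r - 1) * a < a * k * r" by simp
    also have "a * k * r = (a - 1) * (k * r) + k * r" using a2 by (cases a) (simp_all add: algebra_simps)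
    finally show ?thesis by (simp add: mult.commute)
  qed
  have ak: "a = k"
  proof -
    have "k * ((r - 1) * j) < k * r" using ineq j by (simp add: algebra_simps)
    then have "(r - 1) * j < r" by simp
    moreover have "(r - 1) * 2 \<le> (r - 1) * j" if "2 \<le> j" using that by (rule mult_le_mono2)
    ultimately have "\<not> 2 \<le> j" using r3 by linarith
    moreover have "j \<noteq> 0" using j a2 by (intro notI) simp
    ultimately show ?thesis using j by (simp add: not_le numeral_2_eq_2 less_Suc_eq)
  qed
  define T where "T = S - cent_class y"
  have "T \<noteq> {}"
  proof
    assume "T = {}"
    then have "cent_class x \<union> cent_class y = carrier G - {\<one>}"
      using cent_class_subset x(1) y(1) by (auto simp: S_def T_def)
    then have eq: "card (cent_class x) + card (cent_class y) + 1 = n"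
      using card_two_classes[OF x y] finite_carrier n0 by (simp add: n_def order_def)
    have "n * (a * r) = (card (cent_class x) * a) * r + card (cent_class y) * (k * r) + a * r"
      unfolding eq[symmetric] ak by (simp add: algebra_simps)
    also have "\<dots> = n * ((a - 1) * r + (r - 1)) + a * r" unfolding Kx Ky by (simp add: algebra_simps)
    also have "(a - 1) * r + (r - 1) = a * r - 1" using a2 r3 by (cases a) simp_all
    finally have "n * (a * r) = n * (a * r - 1) + a * r" .
    moreover have "n * (a * r) = n * (a * r - 1) + n"
      using a2 r3 by (metis add_mult_distrib2 gr0I le_add_diff_inverse2 less_one linorder_not_less
          mult_is_0 nat_mult_1_right not_numeral_le_zero)
    ultimately have "n = card (norm_cent y)" using k(3) ak by (simp add: r_def)
    moreover have "card (norm_cent y) < n"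
      unfolding n_def order_def using finite_carrier norm_cent_proper[OF y(1,2)]
      by (rule psubset_card_mono)
    ultimately show False by simp
  qed
  have T: "T \<subseteq> carrier G - {\<one>}" "cent_class x \<inter> T = {}" using S by (auto simp: T_def)
  obtain w l v where wT: "w \<in> T" and "Factorial_Ring.prime (card (cent w))"
    and l: "Factorial_Ring.prime l" "l < card (cent w)" "card (norm_cent w) = l * card (cent w)"
    and v: "v \<in> carrier G" "v \<noteq> \<one>" "v [^] l = \<one>" "v \<notin> T"
    by (rule minimal_order_in_class_complement[OF x nx T \<open>T \<noteq> {}\<close>])
  have w: "w \<in> carrier G" "w \<noteq> \<one>" "w \<notin> cent_class x" "w \<notin> cent_class y"
    using wT by (auto simp: S_def T_def)
  define s where "s = card (cent w)"
  have l2: "2 \<le> l" using l(1) by (rule prime_ge_2_nat)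
  then have s3: "3 \<le> s" using l(2) by (simp add: s_def)
  have Kw: "card (cent_class w) * (l * s) = n * (s - 1)"
    using card_cent_class[OF w(1,2)] l(3) by (simp add: n_def s_def)
  have sum3: "card (cent_class x) + card (cent_class y) + card (cent_class w) < n"
  proof -
    have sub: "cent_class x \<union> cent_class y \<union> cent_class w \<subseteq> carrier G - {\<one>}"
      using cent_class_subset x y w by blast
    then have fin: "finite (cent_class x \<union> cent_class y)" "finite (cent_class w)"
      using finite_carrier by (auto intro: finite_subset)
    have "(cent_class x \<union> cent_class y) \<inter> cent_class w = {}"
      using cent_class_disjoint[OF x w(1-3)] cent_class_disjoint[OF y(1,2) w(1,2,4)] by blast
    then have "card (cent_class x) + card (cent_class y) + card (cent_class w)
        = card (cent_class x \<union> cent_class y \<union> cent_class w)"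
      using card_two_classes(1)[OF x y] fin by (simp add: card_Un_disjoint)
    also have "\<dots> \<le> card (carrier G - {\<one>})" using sub finite_carrier by (intro card_mono) auto
    also have "\<dots> < n"
      unfolding n_def order_def using finite_carrier one_closed by (rule card_Diff1_less)
    finally show ?thesis .
  qed
  \<comment> \<open>The classes of \<open>x\<close> and \<open>y\<close> together have \<open>n * (a * r - 1) / (a * r)\<close> elements.\<close>
  have ineq3: "(s - 1) * (a * r) < l * s"
  proof -
    have "(card (cent_class x) + card (cent_class y) + card (cent_class w)) * (a * r * (l * s))
        < n * (a * r * (l * s))"
      using sum3 a2 r3 l2 s3 by simp
    also have "(card (cent_class x) + card (cent_class y) + card (cent_class w)) * (a * r * (l * s))
        = (card (cent_class x) * a) * (r * (l * s)) + (card (cent_class y) * (k * r)) * (l * s)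
          + (card (cent_class w) * (l * s)) * (a * r)"
      by (simp add: algebra_simps ak)
    also have "\<dots> = n * (((a - 1) * r + (r - 1)) * (l * s) + (s - 1) * (a * r))"
      unfolding Kx Ky Kw by (simp add: algebra_simps)
    also have "(a - 1) * r + (r - 1) = a * r - 1" using a2 r3 by (cases a) simp_all
    finally have "(a * r - 1) * (l * s) + (s - 1) * (a * r) < a * r * (l * s)" by simp
    also have "a * r * (l * s) = (a * r - 1) * (l * s) + l * s"
      using a2 r3 by (cases "a * r") simp_all
    finally show ?thesis by simp
  qed
  have "l \<le> a \<or> l \<le> r"
  proof -
    have "v \<in> cent_class x \<or> v \<in> cent_class y" using v by (auto simp: S_def T_def)
    then have "l dvd a \<or> l dvd r"
      using prime_order_in_cent_class x y l(1) v(3) unfolding a_def r_def by blast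
    then show ?thesis using a2 r3 by (auto dest!: dvd_imp_le)
  qed
  moreover have "2 * l \<le> a * r"
    if "l \<le> a \<or> l \<le> r"
    using that
  proof
    assume "l \<le> a"
    then have "2 * l \<le> r * a" using r3 by (intro mult_mono) auto
    then show ?thesis by (simp add: mult.commute)
  next
    assume "l \<le> r"
    then show ?thesis using a2 by (intro mult_mono) auto
  qed
  ultimately have "(s - 1) * (2 * l) \<le> (s - 1) * (a * r)" by (intro mult_le_mono2) blast
  then have "l * (2 * (s - 1)) < l * s" using ineq3 by (simp add: algebra_simps)
  then have "2 * (s - 1) < s" by simp
  then show False using s3 by linarith
qed

end

text \<open>
  If every chain contained a subnormal subgroup, \<open>N\<close> would be the whole group. Then proper
  subnormal subgroups are normal, hence trivial, and a chain \<open>U \<subset> V \<subset> W\<close> of proper subgroups is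
  dominated by a maximal chain of length three. All members of that chain contain \<open>U\<close>, and one of
  them is trivial.
\<close>

lemma (in mixed_minimal_normal) some_chain_without_subnormal:
  "\<exists>C. maximal_chain G 3 C \<and> (\<forall>i\<in>{1..3}. \<not> elementwise_subnormal \<pi> (C i))"
proof (rule ccontr)
  assume "\<not> ?thesis"
  then have chains: "\<exists>i\<in>{1..3}. elementwise_subnormal \<pi> (C i)" if "maximal_chain G 3 C" for C
    using that by blast
  then have NG: "N = carrier G" by (rule minimal_normal_is_whole)
  have simple: "L = {\<one>} \<or> L = carrier G" if "L \<lhd> G" for L
    using minimal that subgroup.one_closed[OF normal_imp_subgroup[OF that]]
      subgroup.subset[OF normal_imp_subgroup[OF that]] by (auto simp: chief_factor_def NG)
  have "short_simple_group G"
  proof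
    show "carrier G \<noteq> {\<one>}" using minimal by (auto simp: chief_factor_def NG)
    show "z = \<one>" if "z \<in> centralizer (carrier G)" for z
      using that center_N_trivial[of z] NG by (simp add: centralizer_def)
    fix U V W
    assume sub: "subgroup U G" "subgroup V G" "subgroup W G"
      and lt: "U \<subset> V" "V \<subset> W" "W \<subset> carrier G"
    obtain M1 where M1: "maximal_subgroup M1 (G\<lparr>carrier := carrier G\<rparr>)" "W \<subseteq> M1"
      using exists_maximal_subgroup[OF finite_carrier sub(3) subgroup_self lt(3)] by blast
    have M1': "subgroup M1 G" "M1 \<subset> carrier G"
      using M1(1) unfolding maximal_subgroup_iff[OF subgroup_self] by blast+
    have "V \<subset> M1" using lt M1 by blast
    then obtain M2 where M2: "maximal_subgroup M2 (G\<lparr>carrier := M1\<rparr>)" "V \<subseteq> M2"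
      using exists_maximal_subgroup[OF finite_carrier sub(2) M1'(1)] by blast
    have M2': "subgroup M2 G" "M2 \<subset> M1"
      using M2(1) unfolding maximal_subgroup_iff[OF M1'(1)] by blast+
    have "U \<subset> M2" using lt M2 by blast
    then obtain M3 where M3: "maximal_subgroup M3 (G\<lparr>carrier := M2\<rparr>)" "U \<subseteq> M3"
      using exists_maximal_subgroup[OF finite_carrier sub(1) M2'(1)] by blast
    have M3': "subgroup M3 G" "M3 \<subset> M2"
      using M3(1) unfolding maximal_subgroup_iff[OF M2'(1)] by blast+
    define C where "C i = [carrier G, M1, M2, M3] ! i" for i
    have C: "C 0 = carrier G" "C 1 = M1" "C 2 = M2" "C 3 = M3" by (simp_all add: C_def)
    have "maximal_chain G 3 C"
      unfolding maximal_chain_three C using M1(1) M2(1) M3(1) by simp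
    then obtain i where "i \<in> {1..3}" and i: "elementwise_subnormal \<pi> (C i)" using chains by blast
    then have "i = 1 \<or> i = 2 \<or> i = 3" by auto
    then have Ci: "subgroup (C i) G" "C i \<subset> carrier G" "U \<subseteq> C i"
      using C M1' M2' M3' M3(2) by auto
    have "normalizes (carrier G) (C i \<inter> carrier G)"
      using subnormal_Int_normalized[OF i] by (simp add: NG)
    moreover have "C i \<inter> carrier G = C i" using Ci(2) by blast
    ultimately have "C i \<lhd> G" using Ci(1) by (simp add: normal_iff_normalizes)
    then have "C i = {\<one>}" using simple Ci(2) by blast
    then show "U = {\<one>}" using Ci(3) subgroup.one_closed[OF sub(1)] by blast
  qed (use finite_carrier simple in blast)+
  then show False by (rule short_simple_group.no_such_group)
qed

section \<open>From nilpotent sections to commuting elements\<close>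

lemma product_group_nat_pow:
  assumes "i \<in> I"
  shows "(u [^]\<^bsub>product_group I H\<^esub> (m::nat)) i = u i [^]\<^bsub>H i\<^esub> m"
  using assms by (induction m) simp_all

text \<open>
  In each primary factor of the direct product, one of the two elements has a trivial
  component, because its order is coprime to the order of the factor.
\<close>

lemma sigma_nilpotent_hall_elements_commute:
  assumes X: "sigma_nilpotent {\<pi>, prime_complement \<pi>} Y"
    and x: "x \<in> carrier Y" "x [^]\<^bsub>Y\<^esub> (m::nat) = \<one>\<^bsub>Y\<^esub>" "pi_number \<pi> m"
    and y: "y \<in> carrier Y" "y [^]\<^bsub>Y\<^esub> (n::nat) = \<one>\<^bsub>Y\<^esub>" "pi_number (- \<pi>) n"
  shows "x \<otimes>\<^bsub>Y\<^esub> y = y \<otimes>\<^bsub>Y\<^esub> x"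
proof -
  obtain N :: nat and H :: "nat \<Rightarrow> 'a monoid"
    where prim: "\<And>i. i \<in> {1..N} \<Longrightarrow> sigma_primary {\<pi>, prime_complement \<pi>} (H i)"
      and iso: "Y \<cong> product_group {1..N} H" and Y: "group Y"
    using X unfolding sigma_nilpotent_def by blast
  let ?P = "product_group {1..N} H"
  obtain f where f: "f \<in> hom Y ?P" "inj_on f (carrier Y)"
    using iso by (auto simp: is_iso_def iso_def bij_betw_def)
  have gH: "group (H i)" if "i \<in> {1..N}" for i
    using prim[OF that] by (auto simp: sigma_primary_def pi_group_def)
  interpret Y: group Y by fact
  interpret P: group ?P by (rule product_group) (rule gH)
  interpret f: group_hom Y ?P f by unfold_locales (rule f(1))
  have mem: "f x i \<in> carrier (H i)" "f y i \<in> carrier (H i)" if "i \<in> {1..N}" for i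
    using f.hom_closed[OF x(1)] f.hom_closed[OF y(1)] that by (auto simp: PiE_iff)
  have pow: "f x i [^]\<^bsub>H i\<^esub> m = \<one>\<^bsub>H i\<^esub>" "f y i [^]\<^bsub>H i\<^esub> n = \<one>\<^bsub>H i\<^esub>" if i: "i \<in> {1..N}" for i
  proof -
    have "f x [^]\<^bsub>?P\<^esub> m = \<one>\<^bsub>?P\<^esub>" "f y [^]\<^bsub>?P\<^esub> n = \<one>\<^bsub>?P\<^esub>"
      using f.hom_nat_pow[OF x(1), of m] f.hom_nat_pow[OF y(1), of n] x(2) y(2) f.hom_one by metis+
    then show "f x i [^]\<^bsub>H i\<^esub> m = \<one>\<^bsub>H i\<^esub>" "f y i [^]\<^bsub>H i\<^esub> n = \<one>\<^bsub>H i\<^esub>"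
      using i by (simp_all flip: product_group_nat_pow[OF i])
  qed
  have "f x i \<otimes>\<^bsub>H i\<^esub> f y i = f y i \<otimes>\<^bsub>H i\<^esub> f x i" if i: "i \<in> {1..N}" for i
  proof -
    interpret Hi: group "H i" by (rule gH[OF i])
    from prim[OF i] consider "pi_group \<pi> (H i)" | "pi_group (prime_complement \<pi>) (H i)"
      by (auto simp: sigma_primary_def)
    then show ?thesis
    proof cases
      case 1
      then have "coprime (order (H i)) n" using coprime_pi_numbers[OF _ y(3)] by (simp add: pi_group_iff)
      moreover have "f y i [^]\<^bsub>H i\<^esub> order (H i) = \<one>\<^bsub>H i\<^esub>" using Hi.pow_order_eq_1 mem i by blast
      ultimately have "f y i = \<one>\<^bsub>H i\<^esub>" using Hi.coprime_powers_eq_one pow(2) mem i by blast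
      then show ?thesis using mem(1)[OF i] by simp
    next
      case 2
      then have "pi_number (- \<pi>) (order (H i))"
        by (auto simp: pi_group_iff pi_number_def prime_complement_def)
      then have "coprime m (order (H i))" using coprime_pi_numbers[OF x(3)] by blast
      moreover have "f x i [^]\<^bsub>H i\<^esub> order (H i) = \<one>\<^bsub>H i\<^esub>" using Hi.pow_order_eq_1 mem i by blast
      ultimately have "f x i = \<one>\<^bsub>H i\<^esub>" using Hi.coprime_powers_eq_one pow(1) mem i by blast
      then show ?thesis using mem(2)[OF i] by simp
    qed
  qed
  then have "f x \<otimes>\<^bsub>?P\<^esub> f y = f y \<otimes>\<^bsub>?P\<^esub> f x" by (auto intro!: restrict_ext)
  then have "f (x \<otimes>\<^bsub>Y\<^esub> y) = f (y \<otimes>\<^bsub>Y\<^esub> x)"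
    by (simp only: f.hom_mult x(1) y(1))
  then show ?thesis by (rule inj_onD[OF f(2)]) (use x y in simp_all)
qed

lemma (in group) sigma_nilpotent_section_hall_parts_commute:
  assumes A: "subgroup A G" and L: "L \<lhd> G\<lparr>carrier := A\<rparr>"
    and nil: "sigma_nilpotent {\<pi>, prime_complement \<pi>} (G\<lparr>carrier := A\<rparr> Mod L)"
  shows "hall_parts_commute \<pi> A L"
  unfolding hall_parts_commute_def
proof (intro ballI allI impI, elim conjE)
  fix a b and m n :: nat
  assume ab: "a \<in> A" "b \<in> A" and mn: "pi_number \<pi> m" "pi_number (- \<pi>) n"
    and pw: "a [^] m \<in> L" "b [^] n \<in> L"
  let ?A = "G\<lparr>carrier := A\<rparr>"
  interpret L: normal L ?A by (rule L)
  have coset: "L #>\<^bsub>?A\<^esub> x = L" if "x \<in> L" for x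
    using that L.subgroup_axioms by (intro L.rcos_const) simp
  have "(L #>\<^bsub>?A\<^esub> a) [^]\<^bsub>?A Mod L\<^esub> m = \<one>\<^bsub>?A Mod L\<^esub>" "(L #>\<^bsub>?A\<^esub> b) [^]\<^bsub>?A Mod L\<^esub> n = \<one>\<^bsub>?A Mod L\<^esub>"
    using ab pw coset L.FactGroup_pow[of a m] L.FactGroup_pow[of b n]
    by (simp_all flip: nat_pow_consistent)
  moreover have "L #>\<^bsub>?A\<^esub> a \<in> carrier (?A Mod L)" "L #>\<^bsub>?A\<^esub> b \<in> carrier (?A Mod L)"
    using ab unfolding carrier_FactGroup by auto
  ultimately have "(L #>\<^bsub>?A\<^esub> a) <#>\<^bsub>?A\<^esub> (L #>\<^bsub>?A\<^esub> b) = (L #>\<^bsub>?A\<^esub> b) <#>\<^bsub>?A\<^esub> (L #>\<^bsub>?A\<^esub> a)"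
    using sigma_nilpotent_hall_elements_commute[OF nil _ _ mn(1) _ _ mn(2)] by simp
  then have "L #>\<^bsub>?A\<^esub> (a \<otimes>\<^bsub>?A\<^esub> b) = L #>\<^bsub>?A\<^esub> (b \<otimes>\<^bsub>?A\<^esub> a)"
    using ab L.rcos_sum[of a b] L.rcos_sum[of b a] by simp
  then have "a \<otimes>\<^bsub>?A\<^esub> b \<in> L #>\<^bsub>?A\<^esub> (b \<otimes>\<^bsub>?A\<^esub> a)"
    using L.rcos_self[of "a \<otimes>\<^bsub>?A\<^esub> b" L] ab L.subgroup_axioms L.m_closed by simp
  then have "\<exists>l\<in>L. a \<otimes> b = l \<otimes> (b \<otimes> a)" by (simp add: r_coset_def)
  then obtain l where l: "l \<in> L" "a \<otimes> b = l \<otimes> (b \<otimes> a)" by blast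
  have c: "a \<in> carrier G" "b \<in> carrier G" "l \<in> carrier G"
    using ab l L.subset subgroup.mem_carrier[OF A] by auto
  have "conj_by a b \<otimes> inv b = (a \<otimes> b) \<otimes> inv (b \<otimes> a)"
    using c by (simp add: conj_by_def m_assoc inv_mult_group)
  also have "\<dots> = l" unfolding l(2) using c by (simp add: m_assoc)
  finally show "conj_by a b \<otimes> inv b \<in> L" using l(1) by simp
qed

section \<open>Passage to a quotient group\<close>

lemma (in group) maximal_chain_subgroup:
  assumes "maximal_chain G n C" "i \<le> n"
  shows "subgroup (C i) G"
  using assms(2)
proof (induction i)
  case 0
  then show ?case using assms(1) by (simp add: maximal_chain_def subgroup_self)
next
  case (Suc i)
  then have sub: "subgroup (C i) G" by simp
  have "Suc i \<in> {1..n}" using Suc.prems by simp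
  then have "maximal_subgroup (C (Suc i)) (G\<lparr>carrier := C (Suc i - 1)\<rparr>)"
    using assms(1) unfolding maximal_chain_def by blast
  then show ?case using maximal_subgroup_iff[OF sub] by simp
qed

locale group_epimorphism = group_hom +
  assumes surj: "h ` carrier G = carrier H"
begin

definition preimage :: "'c set \<Rightarrow> 'a set" where
  "preimage A = {x \<in> carrier G. h x \<in> A}"

lemma hom_conj_by:
  "x \<in> carrier G \<Longrightarrow> y \<in> carrier G \<Longrightarrow> h (G.conj_by x y) = H.conj_by (h x) (h y)"
  by (simp add: G.conj_by_def H.conj_by_def)

lemma kernel_subset_preimage: "subgroup A H \<Longrightarrow> kernel G H h \<subseteq> preimage A"
  by (auto simp: kernel_def preimage_def subgroup.one_closed)

lemma preimage_subgroup: "subgroup A H \<Longrightarrow> subgroup (preimage A) G"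
  by (rule G.subgroupI)
    (auto simp: preimage_def subgroup.m_closed subgroup.m_inv_closed subgroup.one_closed
      intro!: exI[of _ \<one>])

lemma image_preimage: "A \<subseteq> carrier H \<Longrightarrow> h ` preimage A = A"
  using surj by (auto simp: preimage_def image_iff)

lemma image_mem_iff:
  assumes A: "subgroup A G" "kernel G H h \<subseteq> A" and x: "x \<in> carrier G"
  shows "h x \<in> h ` A \<longleftrightarrow> x \<in> A"
proof
  assume "h x \<in> h ` A"
  then obtain a where a: "a \<in> A" "h x = h a" by blast
  have ac: "a \<in> carrier G" using A(1) a(1) by (rule subgroup.mem_carrier)
  have "x \<otimes> inv a \<in> kernel G H h" using x ac a(2) by (simp add: kernel_def)
  then have "x \<otimes> inv a \<otimes> a \<in> A" using A a(1) by (auto intro: subgroup.m_closed)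
  then show "x \<in> A" using x ac by (simp add: G.m_assoc)
qed blast

lemma preimage_image:
  assumes "subgroup A G" "kernel G H h \<subseteq> A"
  shows "preimage (h ` A) = A"
  using assms image_mem_iff[OF assms] subgroup.subset[OF assms(1)] by (auto simp: preimage_def)

lemma maximal_subgroup_preimage:
  assumes B: "subgroup B H" and M: "maximal_subgroup M (H\<lparr>carrier := B\<rparr>)"
  shows "maximal_subgroup (preimage M) (G\<lparr>carrier := preimage B\<rparr>)"
proof -
  have M': "subgroup M H" "M \<subset> B"
    and max: "\<And>K. subgroup K H \<Longrightarrow> M \<subseteq> K \<Longrightarrow> K \<subseteq> B \<Longrightarrow> K = M \<or> K = B"
    using M unfolding H.maximal_subgroup_iff[OF B] by blast+
  have img: "h ` preimage M = M" "h ` preimage B = B"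
    by (rule image_preimage[OF subgroup.subset[OF M'(1)]], rule image_preimage[OF subgroup.subset[OF B]])
  show ?thesis
    unfolding G.maximal_subgroup_iff[OF preimage_subgroup[OF B]]
  proof (intro conjI allI impI)
    show "subgroup (preimage M) G" using M'(1) by (rule preimage_subgroup)
    have "preimage M \<subseteq> preimage B" using M'(2) unfolding preimage_def by blast
    moreover have "preimage M \<noteq> preimage B" using M'(2) img by (metis psubset_eq)
    ultimately show "preimage M \<subset> preimage B" by (rule psubsetI)
    fix K assume K: "subgroup K G \<and> preimage M \<subseteq> K \<and> K \<subseteq> preimage B"
    then have "kernel G H h \<subseteq> K" using kernel_subset_preimage[OF M'(1)] by blast
    then have pre: "preimage (h ` K) = K" using K preimage_image by blast
    have "h ` preimage M \<subseteq> h ` K" "h ` K \<subseteq> h ` preimage B" using K by blast+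
    then have "M \<subseteq> h ` K" "h ` K \<subseteq> B" by (simp_all only: img)
    then have "h ` K = M \<or> h ` K = B" using max K subgroup_img_is_subgroup by blast
    then show "K = preimage M \<or> K = preimage B" using pre by blast
  qed
qed

lemma maximal_chain_preimage:
  assumes "maximal_chain H n C"
  shows "maximal_chain G n (\<lambda>i. preimage (C i))"
proof -
  have "preimage (C 0) = carrier G"
    using assms by (auto simp: maximal_chain_def preimage_def)
  moreover have "maximal_subgroup (preimage (C i)) (G\<lparr>carrier := preimage (C (i - 1))\<rparr>)"
    if i: "i \<in> {1..n}" for i
  proof (rule maximal_subgroup_preimage)
    show "subgroup (C (i - 1)) H" using H.maximal_chain_subgroup[OF assms, of "i - 1"] i by auto
    show "maximal_subgroup (C i) (H\<lparr>carrier := C (i - 1)\<rparr>)"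
      using assms i by (simp add: maximal_chain_def)
  qed
  ultimately show ?thesis by (simp add: maximal_chain_def)
qed

text \<open>
  All members of the chain contain the kernel, and as the kernel is normal, so do the cores
  that occur in the chain. Hence powers and commutators that lie in the image of a core
  come from powers and commutators in the core itself.
\<close>

lemma K_subnormal_image:
  assumes A: "K_subnormal (sigma_nilpotent {\<pi>, prime_complement \<pi>}) G A" "kernel G H h \<subseteq> A"
  shows "H.elementwise_subnormal \<pi> (h ` A)"
proof -
  obtain n and C :: "nat \<Rightarrow> 'a set" where C: "C 0 = A" "C n = carrier G"
    and sub: "\<And>i. i \<le> n \<Longrightarrow> subgroup (C i) G"
    and step: "\<And>i. i \<in> {1..n} \<Longrightarrow> C (i - 1) \<subseteq> C i \<and>
       (C (i - 1) \<lhd> G\<lparr>carrier := C i\<rparr> \<or> sigma_nilpotent {\<pi>, prime_complement \<pi>}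
         (G\<lparr>carrier := C i\<rparr> Mod normal_core (G\<lparr>carrier := C i\<rparr>) (C (i - 1))))"
    using A(1) unfolding K_subnormal_def by blast
  have ker: "kernel G H h \<subseteq> C i" if "i \<le> n" for i
    using that
  proof (induction i)
    case 0
    then show ?case using A(2) C(1) by simp
  next
    case (Suc i)
    then show ?case using step[of "Suc i"] by auto
  qed
  have kerG: "subgroup (kernel G H h) G" "G.normalizes (carrier G) (kernel G H h)"
    using normal_kernel G.normal_iff_normalizes by blast+
  \<comment> \<open>The index counts from the top of the chain, in the direction in which the inductive
    definition proceeds.\<close>
  have "H.elementwise_subnormal \<pi> (h ` C (n - j))" if "j \<le> n" for j
    using that
  proof (induction j)
    case 0
    then show ?case using C(2) surj by (simp add: H.elementwise_subnormal.whole)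
  next
    case (Suc j)
    define S T where "S = C (n - j)" and "T = C (n - Suc j)"
    have i: "n - j \<in> {1..n}" and i1: "n - j - 1 = n - Suc j" using Suc.prems by auto
    have S: "subgroup S G" and T: "subgroup T G" "kernel G H h \<subseteq> T"
      using sub ker Suc.prems by (simp_all add: S_def T_def)
    have TS: "T \<subseteq> S" using step[OF i] unfolding i1 S_def T_def by blast
    from step[OF i] have alt: "T \<lhd> G\<lparr>carrier := S\<rparr> \<or> sigma_nilpotent {\<pi>, prime_complement \<pi>}
         (G\<lparr>carrier := S\<rparr> Mod normal_core (G\<lparr>carrier := S\<rparr>) T)"
      unfolding i1 S_def T_def by blast
    have "\<exists>L. L \<lhd> G\<lparr>carrier := S\<rparr> \<and> kernel G H h \<subseteq> L \<and> L \<subseteq> T \<and>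
        (L = T \<or> G.hall_parts_commute \<pi> S L)"
    proof (cases "T \<lhd> G\<lparr>carrier := S\<rparr>")
      case True
      then show ?thesis using T(2) by blast
    next
      case False
      let ?L = "normal_core (G\<lparr>carrier := S\<rparr>) T"
      have gS: "group (G\<lparr>carrier := S\<rparr>)" and TS': "subgroup T (G\<lparr>carrier := S\<rparr>)"
        using G.subgroup_imp_group[OF S] G.subgroup_in_subgroup_iff[OF S] T TS by auto
      note core = normal_core[OF gS TS']
      have "kernel G H h \<lhd> G\<lparr>carrier := S\<rparr>"
        unfolding G.normal_in_subgroup_iff[OF S]
        using kerG T(2) TS subgroup.subset[OF S] by (auto simp: G.normalizes_def)
      then have "kernel G H h \<subseteq> ?L" using core(3) T(2) by blast
      moreover have "G.hall_parts_commute \<pi> S ?L"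
        using G.sigma_nilpotent_section_hall_parts_commute[OF S core(1)] alt False by blast
      ultimately show ?thesis using core(1,2) by blast
    qed
    then obtain L where L: "L \<lhd> G\<lparr>carrier := S\<rparr>" "kernel G H h \<subseteq> L" "L \<subseteq> T"
      "L = T \<or> G.hall_parts_commute \<pi> S L" by blast
    have L': "subgroup L G" "G.normalizes S L"
      using L(1) by (simp_all add: G.normal_in_subgroup_iff[OF S])
    have Sc: "x \<in> carrier G" if "x \<in> S" for x using S that by (rule subgroup.mem_carrier)
    have Lc: "x \<in> carrier G" if "x \<in> L" for x using L'(1) that by (rule subgroup.mem_carrier)
    have "H.elementwise_subnormal \<pi> (h ` T)"
    proof (rule H.elementwise_subnormal.step[of \<pi> "h ` S" "h ` T" "h ` L"])
      show "H.elementwise_subnormal \<pi> (h ` S)" using Suc by (simp add: S_def)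
      show "subgroup (h ` T) H" "subgroup (h ` L) H"
        using T(1) L'(1) by (simp_all add: subgroup_img_is_subgroup)
      show "h ` T \<subseteq> h ` S" "h ` L \<subseteq> h ` T" using TS L(3) by auto
      show "H.normalizes (h ` S) (h ` L)"
        using L'(2) by (auto simp: H.normalizes_def G.normalizes_def Sc Lc simp flip: hom_conj_by)
      have "H.hall_parts_commute \<pi> (h ` S) (h ` L)" if hc: "G.hall_parts_commute \<pi> S L"
        unfolding H.hall_parts_commute_def
      proof (intro ballI allI impI, elim conjE)
        fix x y and m k :: nat
        assume xy: "x \<in> h ` S" "y \<in> h ` S"
          and mk: "pi_number \<pi> m" "pi_number (- \<pi>) k"
          and pw: "x [^]\<^bsub>H\<^esub> m \<in> h ` L" "y [^]\<^bsub>H\<^esub> k \<in> h ` L"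
        obtain a b where ab: "x = h a" "a \<in> S" "y = h b" "b \<in> S" using xy by blast
        have "h (a [^] m) \<in> h ` L" "h (b [^] k) \<in> h ` L"
          using pw ab by (simp_all add: hom_nat_pow Sc)
        then have "a [^] m \<in> L" "b [^] k \<in> L"
          using image_mem_iff[OF L'(1) L(2)] ab Sc by simp_all
        then have "h (G.conj_by a b \<otimes> inv b) \<in> h ` L"
          using hc mk ab unfolding G.hall_parts_commute_def by blast
        then show "H.conj_by x y \<otimes>\<^bsub>H\<^esub> inv\<^bsub>H\<^esub> y \<in> h ` L"
          using ab by (simp add: hom_conj_by Sc)
      qed
      then show "h ` L = h ` T \<or> H.hall_parts_commute \<pi> (h ` S) (h ` L)" using L(4) by blast
    qed
    then show ?case by (simp add: T_def)
  qed
  from this[of n] show ?thesis using C(1) by simp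
qed

lemma chief_factor_image:
  assumes "chief_factor G N (kernel G H h)"
  shows "chief_factor H (h ` N) {\<one>\<^bsub>H\<^esub>}"
proof -
  let ?K = "kernel G H h"
  have N: "N \<lhd> G" "?K \<subset> N" and min: "\<And>L. L \<lhd> G \<Longrightarrow> ?K \<subseteq> L \<Longrightarrow> L \<subseteq> N \<Longrightarrow> L = ?K \<or> L = N"
    using assms by (auto simp: chief_factor_def)
  have N': "subgroup N G" "G.normalizes (carrier G) N"
    using N(1) by (simp_all add: G.normal_iff_normalizes)
  have Nc: "x \<in> carrier G" if "x \<in> N" for x using N'(1) that by (rule subgroup.mem_carrier)
  have "H.normalizes (carrier H) (h ` N)"
    unfolding H.normalizes_def
  proof (intro ballI)
    fix a b assume "a \<in> carrier H" "b \<in> h ` N"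
    then obtain x y where xy: "x \<in> carrier G" "a = h x" "y \<in> N" "b = h y" using surj by blast
    then have "G.conj_by x y \<in> N" using N'(2) by (simp add: G.normalizes_def)
    then show "H.conj_by a b \<in> h ` N" using xy by (auto simp: Nc simp flip: hom_conj_by)
  qed
  then have "h ` N \<lhd> H" using N'(1) by (simp add: H.normal_iff_normalizes subgroup_img_is_subgroup)
  moreover have "{\<one>\<^bsub>H\<^esub>} \<subset> h ` N"
  proof -
    have "\<one>\<^bsub>H\<^esub> \<in> h ` N" using subgroup.one_closed[OF N'(1)] by (metis hom_one imageI)
    moreover obtain x where "x \<in> N" "x \<notin> ?K" using N(2) by blast
    then have "x \<in> N" "h x \<noteq> \<one>\<^bsub>H\<^esub>" by (auto simp: kernel_def Nc)
    ultimately show ?thesis by auto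
  qed
  moreover have "L = {\<one>\<^bsub>H\<^esub>} \<or> L = h ` N" if L: "L \<lhd> H" "L \<subseteq> h ` N" for L
  proof -
    have Ls: "subgroup L H" "H.normalizes (carrier H) L" using L(1) by (simp_all add: H.normal_iff_normalizes)
    have "G.normalizes (carrier G) (preimage L)"
      using Ls(2) by (auto simp: G.normalizes_def H.normalizes_def preimage_def hom_conj_by)
    then have "preimage L \<lhd> G" using preimage_subgroup[OF Ls(1)] by (simp add: G.normal_iff_normalizes)
    moreover have "preimage L \<subseteq> N"
    proof
      fix x assume "x \<in> preimage L"
      then show "x \<in> N" using L(2) image_mem_iff[OF N'(1)] N(2) by (auto simp: preimage_def)
    qed
    ultimately have "preimage L = ?K \<or> preimage L = N"
      using min kernel_subset_preimage[OF Ls(1)] by blast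
    moreover have "h ` ?K = {\<one>\<^bsub>H\<^esub>}" by (force simp: kernel_def)
    ultimately show ?thesis using image_preimage[OF subgroup.subset[OF Ls(1)]] by metis
  qed
  moreover have "{\<one>\<^bsub>H\<^esub>} \<lhd> H" by (rule H.one_is_normal)
  ultimately show ?thesis by (simp add: chief_factor_def)
qed

end

theorem corollary1p7:
  fixes G :: "('a, 'b) monoid_scheme" and \<pi> :: "nat set" and \<sigma> :: "nat set set"
  assumes "\<pi> \<subseteq> {p. Factorial_Ring.prime p}" and "\<pi> \<noteq> {}"
    and "\<sigma> = {\<pi>, prime_complement \<pi>}"
    and "group G" and "finite (carrier G)"
    and "\<And>M. maximal_chain G 3 M \<Longrightarrow> \<exists>i\<in>{1..3}. K_subnormal (sigma_nilpotent \<sigma>) G (M i)"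
  shows "pi_separable \<pi> G"
proof (unfold pi_separable_def, intro allI impI, rule ccontr)
  fix H K
  assume HK: "chief_factor G H K"
    and mixed: "\<not> (pi_group \<pi> (G\<lparr>carrier := H\<rparr> Mod K) \<or>
      pi_group (prime_complement \<pi>) (G\<lparr>carrier := H\<rparr> Mod K))"
  interpret G: group G by fact
  have K: "K \<lhd> G" and H: "subgroup H G" "K \<subseteq> H" and nH: "G.normalizes (carrier G) K"
    using HK by (auto simp: chief_factor_def G.normal_iff_normalizes)
  interpret K: normal K G by (rule K)
  have K': "subgroup K G" using K by (rule normal_imp_subgroup)
  let ?Q = "G Mod K" and ?h = "\<lambda>x. K #>\<^bsub>G\<^esub> x"
  interpret Q: group ?Q by (rule K.factorgroup_is_group)
  interpret h: group_epimorphism G ?Q ?h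
    by unfold_locales (simp_all add: K.r_coset_hom_Mod carrier_FactGroup)
  have ker: "kernel G ?Q ?h = K"
    using G.coset_join1[OF _ _ K'] G.coset_join2[OF _ K'] K.mem_carrier
    unfolding kernel_def by auto
  let ?N = "?h ` H"
  have carrier_section: "carrier (G\<lparr>carrier := H\<rparr> Mod K) = ?N"
    by (simp add: carrier_FactGroup)
  have finN: "finite ?N" using assms(5) H(1) finite_subset subgroup.subset by blast
  have "K \<lhd> G\<lparr>carrier := H\<rparr>"
    unfolding G.normal_in_subgroup_iff[OF H(1)]
    using K' H nH subgroup.subset[OF H(1)] by (auto simp: G.normalizes_def)
  then have "group (G\<lparr>carrier := H\<rparr> Mod K)" by (rule normal.factorgroup_is_group)
  then obtain p q where "Factorial_Ring.prime p" "p dvd card ?N" "p \<in> \<pi>"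
    and "Factorial_Ring.prime q" "q dvd card ?N" "q \<notin> \<pi>"
    using mixed finN by (auto simp: pi_group_def prime_complement_def order_def carrier_section)
  then interpret N: mixed_minimal_normal ?Q \<pi> ?N p q
    using h.chief_factor_image HK ker assms(5) by unfold_locales (auto simp: carrier_FactGroup)
  obtain C where C: "maximal_chain ?Q 3 C" "\<forall>i\<in>{1..3}. \<not> Q.elementwise_subnormal \<pi> (C i)"
    using N.some_chain_without_subnormal by blast
  obtain i where i: "i \<in> {1..3}" "K_subnormal (sigma_nilpotent \<sigma>) G (h.preimage (C i))"
    using assms(6)[OF h.maximal_chain_preimage[OF C(1)]] by blast
  have Ci: "subgroup (C i) ?Q" using Q.maximal_chain_subgroup[OF C(1)] i(1) by simp
  then have "Q.elementwise_subnormal \<pi> (?h ` h.preimage (C i))"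
    using h.K_subnormal_image i(2) h.kernel_subset_preimage assms(3) by blast
  then show False using C(2) i(1) h.image_preimage[OF subgroup.subset[OF Ci]] by simp
qed

end
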